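(* Let $G=G(I,P;E)$ be an Assur graph such that $G$ and the graph $G^*$ obtained by identifying all pinned vertices to one vertex are planar. Then there is a configuration $\mathbf p$ of $I\cup P$ in $\mathbb R^2$ (with distinct positions for the pinned vertices) such that: (1) the pinned framework $G(\mathbf p)$ has a one-dimensional space of self-stresses, spanned by a self-stress which is non-zero on every edge; and (2) $G(\mathbf p)$ has, up to scalar multiples, a unique non-trivial first-order motion (with the pinned vertices fixed), and this motion assigns a non-zero velocity to every inner vertex.
   Context: A pinned graph $G(I,P;E)$ has a set $I$ of inner vertices, a set $P$ of pinned vertices, and edge set $E$ in which every edge has at least one endpoint in $I$. A pinned framework $G(\mathbf p)$ places all vertices at points of $\mathbb R^2$, pinned vertices regarded as fixed. A first-order motion assigns $\mathbf p'_i\in\mathbb R^2$ to inner vertices ($\mathbf p'_v=\mathbf 0$ for $v\in P$) with $(\mathbf p_i-\mathbf p_j)\cdot(\mathbf p'_i-\mathbf p'_j)=0$ for all edges $ij$. A self-stress is an assignment of scalars $\lambda_{ij}$ to edges with $\sum_{j:ij\in E}\lambda_{ij}(\mathbf p_i-\mathbf p_j)=\mathbf 0$ at every inner vertex $i$ (a row dependency of the $|E|\times 2|I|$ pinned rigidity matrix). Pinned Framework Conditions: $|E|=2|I|$ and for every subgraph $G'(I',P';E')$ with $E'\ne\emptyset$: $|E'|\le 2|I'|$ if $|P'|\ge2$, $|E'|\le 2|I'|-1$ if $|P'|=1$, $|E'|\le 2|I'|-3$ if $P'=\emptyset$; graphs satisfying these are called pinned isostatic. A rigidity circuit is a (multi)graph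 with edge set $C$, $|C|=2|V(C)|-2$, and every nonempty proper subset $F$ satisfies $|F|\le 2|V(F)|-3$. An Assur graph is a pinned isostatic graph such that identifying all pinned vertices to a single vertex (keeping all edges) yields a rigidity circuit. *)

theory Defs
  imports "HOL-Analysis.Analysis"
begin

text \<open>A (multi)graph is given by a finite edge set E together with two endpoint
  maps s t.  A pinned graph G(I,P;E): inner vertices I, pinned vertices P.\<close>

definition pinned_graph :: "'v set \<Rightarrow> 'v set \<Rightarrow> 'e set \<Rightarrow> ('e \<Rightarrow> 'v) \<Rightarrow> ('e \<Rightarrow> 'v) \<Rightarrow> bool" where
  "pinned_graph I P E s t \<longleftrightarrow> finite I \<and> finite P \<and> finite E \<and> I \<inter> P = {} \<and>
     (\<forall>e\<in>E. s e \<in> I \<union> P \<and> t e \<in> I \<union> P \<and> s e \<noteq> t e \<and> (s e \<in> I \<or> t e \<in> I))"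

definition pinned_isostatic :: "'v set \<Rightarrow> 'v set \<Rightarrow> 'e set \<Rightarrow> ('e \<Rightarrow> 'v) \<Rightarrow> ('e \<Rightarrow> 'v) \<Rightarrow> bool" where
  "pinned_isostatic I P E s t \<longleftrightarrow> pinned_graph I P E s t \<and>
     int (card E) = 2 * int (card I) \<and>
     (\<forall>I' P' E'. I' \<subseteq> I \<longrightarrow> P' \<subseteq> P \<longrightarrow> E' \<subseteq> E \<longrightarrow> E' \<noteq> {} \<longrightarrow>
        (\<forall>e\<in>E'. s e \<in> I' \<union> P' \<and> t e \<in> I' \<union> P') \<longrightarrow>
        (if card P' \<ge> 2 then int (card E') \<le> 2 * int (card I')
         else if card P' = 1 then int (card E') \<le> 2 * int (card I') - 1
         else int (card E') \<le> 2 * int (card I') - 3))"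

definition edge_verts :: "'e set \<Rightarrow> ('e \<Rightarrow> 'w) \<Rightarrow> ('e \<Rightarrow> 'w) \<Rightarrow> 'w set" where
  "edge_verts F a b = a ` F \<union> b ` F"

definition rigidity_circuit :: "'e set \<Rightarrow> ('e \<Rightarrow> 'w) \<Rightarrow> ('e \<Rightarrow> 'w) \<Rightarrow> bool" where
  "rigidity_circuit C a b \<longleftrightarrow> finite C \<and>
     int (card C) = 2 * int (card (edge_verts C a b)) - 2 \<and>
     (\<forall>F. F \<subset> C \<longrightarrow> F \<noteq> {} \<longrightarrow> int (card F) \<le> 2 * int (card (edge_verts F a b)) - 3)"

definition ident_pins :: "'v set \<Rightarrow> 'v \<Rightarrow> 'v option" where
  "ident_pins P v = (if v \<in> P then None else Some v)"

definition assur_graph :: "'v set \<Rightarrow> 'v set \<Rightarrow> 'e set \<Rightarrow> ('e \<Rightarrow> 'v) \<Rightarrow> ('e \<Rightarrow> 'v) \<Rightarrow> bool" where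
  "assur_graph I P E s t \<longleftrightarrow> pinned_isostatic I P E s t \<and>
     rigidity_circuit E (ident_pins P \<circ> s) (ident_pins P \<circ> t)"

definition planar :: "'w set \<Rightarrow> 'e set \<Rightarrow> ('e \<Rightarrow> 'w) \<Rightarrow> ('e \<Rightarrow> 'w) \<Rightarrow> bool" where
  "planar V E a b \<longleftrightarrow> (\<exists>(pos :: 'w \<Rightarrow> real^2) (\<gamma> :: 'e \<Rightarrow> real \<Rightarrow> real^2).
     inj_on pos V \<and>
     (\<forall>e\<in>E. arc (\<gamma> e) \<and> pathstart (\<gamma> e) = pos (a e) \<and> pathfinish (\<gamma> e) = pos (b e)) \<and>
     (\<forall>e\<in>E. \<forall>v\<in>V. v \<noteq> a e \<longrightarrow> v \<noteq> b e \<longrightarrow> pos v \<notin> path_image (\<gamma> e)) \<and>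
     (\<forall>e\<in>E. \<forall>e'\<in>E. e \<noteq> e' \<longrightarrow>
        path_image (\<gamma> e) \<inter> path_image (\<gamma> e') \<subseteq>
          {pos (a e), pos (b e)} \<inter> {pos (a e'), pos (b e')}))"

definition first_order_motion :: "'v set \<Rightarrow> 'e set \<Rightarrow> ('e \<Rightarrow> 'v) \<Rightarrow> ('e \<Rightarrow> 'v) \<Rightarrow>
    ('v \<Rightarrow> real^2) \<Rightarrow> ('v \<Rightarrow> real^2) \<Rightarrow> bool" where
  "first_order_motion I E s t p p' \<longleftrightarrow> (\<forall>v. v \<notin> I \<longrightarrow> p' v = 0) \<and>
     (\<forall>e\<in>E. (p (s e) - p (t e)) \<bullet> (p' (s e) - p' (t e)) = 0)"

definition self_stress :: "'v set \<Rightarrow> 'e set \<Rightarrow> ('e \<Rightarrow> 'v) \<Rightarrow> ('e \<Rightarrow> 'v) \<Rightarrow>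
    ('v \<Rightarrow> real^2) \<Rightarrow> ('e \<Rightarrow> real) \<Rightarrow> bool" where
  "self_stress I E s t p \<omega> \<longleftrightarrow> (\<forall>e. e \<notin> E \<longrightarrow> \<omega> e = 0) \<and>
     (\<forall>i\<in>I. (\<Sum>e\<in>{e\<in>E. s e = i}. \<omega> e *\<^sub>R (p i - p (t e))) +
            (\<Sum>e\<in>{e\<in>E. t e = i}. \<omega> e *\<^sub>R (p i - p (s e))) = 0)"

end

theory Submission
  imports Defs "HOL-Library.Function_Algebras"
begin

text \<open>Place the circuit obtained by identifying the pins generically. By Laman's theorem its edges,
  minus any one of them, have independent rows, while the rotation of the plane makes all of them
  together dependent. So the dependency is unique up to scalars and nowhere zero, and the rotation
  about the identified pin is, up to scalars, the only motion fixing that pin. It moves every inner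
  vertex, because no two vertices coincide. Both conclusions depend only on the directions of the
  edges, so it suffices to draw the pinned graph with the same edge directions but distinct pins.
  The pin positions that extend to such a drawing form a subspace of codimension at most one, which
  contains tuples of distinct points.

  Laman's theorem is proved by Lovasz's hyperplane argument. Directions chosen generically and
  independently for the edges of a Laman-sparse graph give independent rows, even after one edge is
  doubled. A placement orthogonal to these directions that collapses no edge is, up to a quarter
  turn, a drawing with these directions.\<close>

section \<open>Functions as a real vector space\<close>

instantiation "fun" :: (type, real_vector) real_vector
begin

definition "r *\<^sub>R f = (\<lambda>x. r *\<^sub>R f x)"

instance
  by standard (simp_all add: scaleR_fun_def fun_eq_iff algebra_simps)

end

lemma scaleR_fun_apply [simp]: "(r *\<^sub>R f) x = r *\<^sub>R f x"
  by (simp add: scaleR_fun_def)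

lemma sum_fun_apply [simp]: "sum f A x = (\<Sum>i\<in>A. f i x)"
  by (induction A rule: infinite_finite_induct) simp_all

section \<open>Independent families\<close>

definition indep_family :: "('i \<Rightarrow> 'a::real_vector) \<Rightarrow> 'i set \<Rightarrow> bool" where
  "indep_family u S \<longleftrightarrow> inj_on u S \<and> independent (u ` S)"

lemma indep_family_empty [simp]: "indep_family u {}"
  by (simp add: indep_family_def independent_empty)

lemma indep_family_insert:
  assumes "i \<notin> S"
  shows "indep_family u (insert i S) \<longleftrightarrow> indep_family u S \<and> u i \<notin> span (u ` S)"
proof (cases "u i \<in> u ` S")
  case True
  then have "u i \<in> span (u ` S)" by (rule span_base)
  then show ?thesis using True assms by (simp add: indep_family_def)
next
  case False
  then show ?thesis using assms by (auto simp: indep_family_def independent_insert)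
qed

lemma indep_family_subset: "indep_family u S \<Longrightarrow> T \<subseteq> S \<Longrightarrow> indep_family u T"
  unfolding indep_family_def by (meson image_mono independent_mono inj_on_subset)

lemma indep_family_cong:
  "(\<And>i. i \<in> S \<Longrightarrow> u i = v i) \<Longrightarrow> indep_family u S \<longleftrightarrow> indep_family v S"
  unfolding indep_family_def by (simp cong: inj_on_cong image_cong)

lemma indep_family_card_le:
  assumes "indep_family u S" "u ` S \<subseteq> span A" "finite A"
  shows "card S \<le> card A"
  using assms independent_span_bound[of A "u ` S"] by (simp add: indep_family_def card_image)

lemma indep_family_insert_vector:
  assumes "finite S" "indep_family u S" "y \<notin> span (u ` S)"
  shows "independent (insert y (u ` S))" "card (insert y (u ` S)) = Suc (card S)"
  using assms span_base[of y "u ` S"]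
  by (auto simp: indep_family_def independent_insertI card_insert_if card_image)

lemma independent_card_ge_spans:
  fixes A B :: "'a::real_vector set"
  assumes "independent B" "B \<subseteq> span A" "finite A" "card A \<le> card B"
  shows "A \<subseteq> span B"
proof
  fix x assume "x \<in> A"
  show "x \<in> span B"
  proof (rule ccontr)
    assume not_in_span: "x \<notin> span B"
    then have "independent (insert x B)"
      using assms(1) by (simp add: independent_insertI)
    moreover have "insert x B \<subseteq> span A"
      using assms(2) \<open>x \<in> A\<close> by (simp add: span_base)
    ultimately have "finite (insert x B) \<and> card (insert x B) \<le> card A"
      by (rule independent_span_bound[OF assms(3)])
    moreover have "x \<notin> B" using not_in_span span_base[of x B] by blast
    ultimately show False using assms(4) by (auto simp: card_insert_if)
  qed
qed

lemma indep_family_reindex: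
  assumes "inj_on g S"
  shows "indep_family u (g ` S) \<longleftrightarrow> indep_family (\<lambda>i. u (g i)) S"
  using comp_inj_on_iff[OF assms, of u] by (simp add: indep_family_def image_image o_def)

lemma in_span_family_iff:
  assumes "finite S"
  shows "x \<in> span (u ` S) \<longleftrightarrow> (\<exists>c. x = (\<Sum>i\<in>S. c i *\<^sub>R u i))"
proof
  assume "x \<in> span (u ` S)"
  with assms show "\<exists>c. x = (\<Sum>i\<in>S. c i *\<^sub>R u i)"
  proof (induction S arbitrary: x rule: finite_induct)
    case (insert i S)
    obtain k where "x - k *\<^sub>R u i \<in> span (u ` S)"
      using insert.prems span_breakdown_eq[of x "u i" "u ` S"] by auto
    then obtain c where "x - k *\<^sub>R u i = (\<Sum>j\<in>S. c j *\<^sub>R u j)"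
      using insert.IH by blast
    moreover have "(\<Sum>j\<in>S. c j *\<^sub>R u j) = (\<Sum>j\<in>S. (c(i := k)) j *\<^sub>R u j)"
      using insert.hyps by (intro sum.cong) auto
    ultimately show ?case
      using insert.hyps by (intro exI[of _ "c(i := k)"]) (simp add: algebra_simps)
  qed simp
qed (auto intro!: span_sum span_scale intro: span_base)

lemma indep_familyD:
  assumes "indep_family u S" "finite S" "(\<Sum>i\<in>S. c i *\<^sub>R u i) = 0" "i \<in> S"
  shows "c i = 0"
proof -
  have "(\<Sum>x\<in>u ` S. c (inv_into S u x) *\<^sub>R x) = (\<Sum>i\<in>S. c i *\<^sub>R u i)"
    using assms(1) by (simp add: indep_family_def sum.reindex)
  then show ?thesis
    using assms independentD[of "u ` S" "u ` S" "\<lambda>x. c (inv_into S u x)" "u i"]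
    by (simp add: indep_family_def)
qed

lemma indep_familyI:
  assumes "finite S" "\<And>c i. (\<Sum>i\<in>S. c i *\<^sub>R u i) = 0 \<Longrightarrow> i \<in> S \<Longrightarrow> c i = 0"
  shows "indep_family u S"
  using assms
proof (induction S rule: finite_induct)
  case empty
  show ?case by simp
next
  case (insert i S)
  have update: "(\<Sum>j\<in>S. (c(i := r)) j *\<^sub>R u j) = (\<Sum>j\<in>S. c j *\<^sub>R u j)" for c r
    using insert.hyps by (intro sum.cong) auto
  have "indep_family u S"
  proof (rule insert.IH)
    fix c j assume "(\<Sum>j\<in>S. c j *\<^sub>R u j) = 0" "j \<in> S"
    then show "c j = 0"
      using insert.prems[of "c(i := 0)" j] insert.hyps update[of c 0] by (auto split: if_splits)
  qed
  moreover have "u i \<notin> span (u ` S)"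
  proof
    assume "u i \<in> span (u ` S)"
    then obtain c where "u i = (\<Sum>j\<in>S. c j *\<^sub>R u j)"
      using insert.hyps by (auto simp: in_span_family_iff)
    then have "(c(i := - 1)) i = 0"
      using insert.prems[of "c(i := - 1)" i] insert.hyps update[of c "- 1"] by simp
    then show False by simp
  qed
  ultimately show ?case using insert.hyps by (simp add: indep_family_insert)
qed

lemma indep_family_iff_scalars:
  assumes "finite S"
  shows "indep_family u S \<longleftrightarrow> (\<forall>c. (\<Sum>i\<in>S. c i *\<^sub>R u i) = 0 \<longrightarrow> (\<forall>i\<in>S. c i = 0))"
  using assms indep_familyD[of u S] indep_familyI[of S u] by blast

lemma indep_family_scale_iff:
  assumes "finite S" "\<And>i. i \<in> S \<Longrightarrow> g i \<noteq> 0"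
  shows "indep_family (\<lambda>i. g i *\<^sub>R u i) S \<longleftrightarrow> indep_family u S"
proof -
  have scale: "indep_family (\<lambda>i. h i *\<^sub>R v i) S" if "indep_family v S" "\<And>i. i \<in> S \<Longrightarrow> h i \<noteq> 0"
    for h :: "'a \<Rightarrow> real" and v :: "'a \<Rightarrow> 'b"
  proof (rule indep_familyI[OF assms(1)])
    fix c i assume "(\<Sum>i\<in>S. c i *\<^sub>R h i *\<^sub>R v i) = 0" "i \<in> S"
    then have "c i * h i = 0"
      using indep_familyD[OF that(1) assms(1), of "\<lambda>i. c i * h i"] by simp
    then show "c i = 0" using that(2)[OF \<open>i \<in> S\<close>] by simp
  qed
  have "indep_family (\<lambda>i. inverse (g i) *\<^sub>R g i *\<^sub>R u i) S \<longleftrightarrow> indep_family u S"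
    using assms(2) by (intro indep_family_cong) simp
  then show ?thesis
    using scale[of u g] scale[of "\<lambda>i. g i *\<^sub>R u i" "\<lambda>i. inverse (g i)"] assms(2) by auto
qed

lemma indep_family_linear_extend:
  assumes "indep_family u S"
  obtains T where "linear T" "\<And>i. i \<in> S \<Longrightarrow> T (u i) = w i"
proof -
  obtain T where "linear T" "\<forall>x\<in>u ` S. T x = (w \<circ> inv_into S u) x"
    using linear_independent_extend assms unfolding indep_family_def by blast
  then show ?thesis
    using that assms by (simp add: indep_family_def)
qed

lemma ex_separating_functional:
  fixes y :: "'a::real_vector"
  assumes "y \<notin> span A"
  obtains f :: "'a \<Rightarrow> real" where "linear f" "f y = 1" "\<And>x. x \<in> span A \<Longrightarrow> f x = 0"
proof -
  obtain B where basis: "independent B" "span B = span A"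
    by (metis maximal_independent_subset span_eq span_superset subset_trans)
  then have "independent (insert y B)"
    using assms by (simp add: independent_insertI)
  then obtain f where functional: "linear f" "\<forall>x\<in>insert y B. f x = (of_bool (x = y) :: real)"
    using linear_independent_extend[of _ "\<lambda>x. of_bool (x = y)"] by blast
  moreover have "y \<notin> B"
    using assms basis(2) span_base[of y B] by auto
  ultimately have "f x = 0" if "x \<in> span B" for x
    using linear_eq_0_on_span[of f B] that by fastforce
  then show ?thesis using that functional basis(2) by simp
qed

text \<open>If the right-hand side obeys every relation between the rows, then the point (0, 1) lies
  outside the span of the augmented rows, and a functional separating them solves the system.\<close>

lemma fredholm_alternative:
  fixes u :: "'i \<Rightarrow> 'a::real_vector" and \<beta> :: "'i \<Rightarrow> real"
  assumes "finite S"
    and compatible: "\<And>\<omega>. (\<Sum>i\<in>S. \<omega> i *\<^sub>R u i) = 0 \<Longrightarrow> (\<Sum>i\<in>S. \<omega> i * \<beta> i) = 0"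
  obtains f :: "'a \<Rightarrow> real" where "linear f" "\<And>i. i \<in> S \<Longrightarrow> f (u i) = \<beta> i"
proof -
  define v where "v = (\<lambda>i. (u i, \<beta> i))"
  have "(0, 1) \<notin> span (v ` S)"
  proof
    assume "(0, 1) \<in> span (v ` S)"
    then obtain \<omega> where combination: "(0, 1) = (\<Sum>i\<in>S. \<omega> i *\<^sub>R v i)"
      using in_span_family_iff[OF assms(1)] by blast
    have "(\<Sum>i\<in>S. \<omega> i *\<^sub>R u i) = 0"
      using arg_cong[OF combination, of fst] by (simp add: v_def fst_sum)
    moreover have "(\<Sum>i\<in>S. \<omega> i * \<beta> i) = 1"
      using arg_cong[OF combination, of snd] by (simp add: v_def snd_sum)
    ultimately show False using compatible by simp
  qed
  then obtain g where separating: "linear g" "g (0, 1) = (1::real)" "\<And>z. z \<in> span (v ` S) \<Longrightarrow> g z = 0"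
    using ex_separating_functional by blast
  define f where "f = (\<lambda>x. - g (x, 0))"
  have "linear f"
  proof (rule linearI)
    show "f (x + y) = f x + f y" for x y
      using linear_add[OF separating(1), of "(x, 0)" "(y, 0)"] by (simp add: f_def)
    show "f (r *\<^sub>R x) = r *\<^sub>R f x" for r x
      using linear_scale[OF separating(1), of r "(x, 0)"] by (simp add: f_def)
  qed
  moreover have "f (u i) = \<beta> i" if "i \<in> S" for i
  proof -
    have "g (u i, 0) + \<beta> i * g (0, 1) = g (v i)"
      using linear_add[OF separating(1), of "(u i, 0)" "(0, \<beta> i)"]
        linear_scale[OF separating(1), of "\<beta> i" "(0, 1)"]
      by (simp add: v_def)
    also have "\<dots> = 0" using separating(3) that by (simp add: span_base)
    finally show ?thesis using separating(2) by (simp add: f_def)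
  qed
  ultimately show ?thesis using that by blast
qed

definition family_circuit :: "('i \<Rightarrow> 'a::real_vector) \<Rightarrow> 'i set \<Rightarrow> bool" where
  "family_circuit u C \<longleftrightarrow>
     finite C \<and> \<not> indep_family u C \<and> (\<forall>i\<in>C. indep_family u (C - {i}))"

lemma ex_family_circuit:
  assumes "finite S" "\<not> indep_family u S"
  obtains C where "C \<subseteq> S" "family_circuit u C"
proof -
  obtain C where minimal: "C \<in> {T. T \<subseteq> S \<and> \<not> indep_family u T}"
      "\<And>T. T \<in> {T. T \<subseteq> S \<and> \<not> indep_family u T} \<Longrightarrow> T \<subseteq> C \<Longrightarrow> C = T"
    using finite_has_minimal[of "{T. T \<subseteq> S \<and> \<not> indep_family u T}"] assms by auto
  have "indep_family u (C - {i})" if "i \<in> C" for i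
    using minimal(1) minimal(2)[of "C - {i}"] that by blast
  moreover have "finite C" using minimal(1) assms(1) finite_subset by blast
  ultimately show ?thesis
    using that[of C] minimal(1) by (simp add: family_circuit_def)
qed

lemma family_circuit_nonempty: "family_circuit u C \<Longrightarrow> C \<noteq> {}"
  by (auto simp: family_circuit_def)

lemma family_circuit_psubset:
  assumes "family_circuit u C" "D \<subset> C"
  shows "indep_family u D"
proof -
  obtain i where "i \<in> C" "D \<subseteq> C - {i}" using assms(2) by blast
  then show ?thesis
    using assms(1) indep_family_subset[of u "C - {i}" D] by (simp add: family_circuit_def)
qed

lemma family_circuit_in_span:
  assumes "family_circuit u C" "i \<in> C"
  shows "u i \<in> span (u ` (C - {i}))"
proof -
  have "insert i (C - {i}) = C" using assms(2) by blast
  then show ?thesis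
    using assms indep_family_insert[of i "C - {i}" u] by (simp add: family_circuit_def)
qed

lemma family_circuit_span_delete:
  assumes "family_circuit u C" "i \<in> C"
  shows "span (u ` (C - {i})) = span (u ` C)"
proof -
  have "u ` C = insert (u i) (u ` (C - {i}))" using assms(2) by auto
  then show ?thesis using span_redundant[OF family_circuit_in_span[OF assms]] by simp
qed

lemma family_circuit_dependency:
  assumes circuit: "family_circuit u C"
  shows "\<exists>\<omega>. (\<Sum>i\<in>C. \<omega> i *\<^sub>R u i) = 0 \<and> (\<forall>i\<in>C. \<omega> i \<noteq> 0) \<and>
    (\<forall>\<mu>. (\<Sum>i\<in>C. \<mu> i *\<^sub>R u i) = 0 \<longrightarrow> (\<exists>c. \<forall>i\<in>C. \<mu> i = c * \<omega> i))"
proof -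
  have fin: "finite C" using circuit by (simp add: family_circuit_def)
  have vanishing: "\<mu> j = 0"
    if "(\<Sum>i\<in>C. \<mu> i *\<^sub>R u i) = 0" "i \<in> C" "\<mu> i = 0" "j \<in> C" for \<mu> i j
  proof (cases "j = i")
    case False
    have "(\<Sum>i\<in>C - {i}. \<mu> i *\<^sub>R u i) = 0"
      using that fin sum.remove[of C i "\<lambda>i. \<mu> i *\<^sub>R u i"] by simp
    then show ?thesis
      using indep_familyD[of u "C - {i}" \<mu> j] that circuit fin False
      by (simp add: family_circuit_def)
  qed (use that in simp)
  obtain \<omega> k where dependency: "(\<Sum>i\<in>C. \<omega> i *\<^sub>R u i) = 0" "k \<in> C" "\<omega> k \<noteq> 0"
    using circuit indep_family_iff_scalars[OF fin, of u] unfolding family_circuit_def by blast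
  have "\<exists>c. \<forall>i\<in>C. \<mu> i = c * \<omega> i" if other: "(\<Sum>i\<in>C. \<mu> i *\<^sub>R u i) = 0" for \<mu>
  proof -
    define c where "c = \<mu> k / \<omega> k"
    have "(\<Sum>i\<in>C. (\<mu> i - c * \<omega> i) *\<^sub>R u i)
        = (\<Sum>i\<in>C. \<mu> i *\<^sub>R u i) - c *\<^sub>R (\<Sum>i\<in>C. \<omega> i *\<^sub>R u i)"
      by (simp add: scaleR_left_diff_distrib sum_subtractf scaleR_sum_right)
    then have "\<mu> i - c * \<omega> i = 0" if "i \<in> C" for i
      using vanishing[of "\<lambda>i. \<mu> i - c * \<omega> i" k i] other dependency that by (simp add: c_def)
    then show ?thesis by (intro exI[of _ c]) simp
  qed
  moreover have "\<omega> i \<noteq> 0" if "i \<in> C" for i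
    using vanishing[OF dependency(1) that _ dependency(2)] dependency(3) by blast
  ultimately show ?thesis using dependency(1) by blast
qed

section \<open>Genericity\<close>

definition generic_on :: "'a::real_vector set \<Rightarrow> ('a \<Rightarrow> bool) \<Rightarrow> bool" where
  "generic_on S Q \<longleftrightarrow> (\<exists>x\<in>S. Q x) \<and>
     (\<forall>x\<in>S. \<forall>y\<in>S. Q x \<longrightarrow> finite {r. \<not> Q ((1 - r) *\<^sub>R x + r *\<^sub>R y)})"

lemma generic_on_conj:
  assumes "affine S" "generic_on S Q" "generic_on S R"
  shows "generic_on S (\<lambda>x. Q x \<and> R x)"
proof -
  obtain x y where witnesses: "x \<in> S" "Q x" "y \<in> S" "R y"
    using assms unfolding generic_on_def by blast
  define exceptional where
    "exceptional = (\<lambda>Q' x y. {r::real. \<not> Q' ((1 - r) *\<^sub>R x + r *\<^sub>R (y::'a))})"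
  have finite_exceptional: "finite (exceptional Q x y)" "finite (exceptional R y x)"
    using assms witnesses by (auto simp: generic_on_def exceptional_def)
  have "{r. \<not> R ((1 - r) *\<^sub>R x + r *\<^sub>R y)} = (\<lambda>r. 1 - r) ` exceptional R y x"
    by (auto simp: exceptional_def add.commute intro: image_eqI[of _ _ "1 - _"])
  then have "finite (exceptional Q x y \<union> {r. \<not> R ((1 - r) *\<^sub>R x + r *\<^sub>R y)})"
    using finite_exceptional by simp
  then obtain r where "r \<notin> exceptional Q x y \<union> {r. \<not> R ((1 - r) *\<^sub>R x + r *\<^sub>R y)}"
    using ex_new_if_finite infinite_UNIV_char_0 by blast
  moreover have "(1 - r) *\<^sub>R x + r *\<^sub>R y \<in> S"
    using assms(1) witnesses by (simp add: affine_alt)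
  ultimately have "\<exists>z\<in>S. Q z \<and> R z"
    by (auto simp: exceptional_def)
  moreover have "finite {r. \<not> (Q ((1 - r) *\<^sub>R x + r *\<^sub>R y) \<and> R ((1 - r) *\<^sub>R x + r *\<^sub>R y))}"
    if "x \<in> S" "y \<in> S" "Q x" "R x" for x y
    using assms(2,3) that unfolding generic_on_def de_Morgan_conj Collect_disj_eq finite_Un by blast
  ultimately show ?thesis
    by (simp add: generic_on_def)
qed

lemma generic_on_ball:
  assumes "affine S" "S \<noteq> {}" "finite J" "\<And>j. j \<in> J \<Longrightarrow> generic_on S (Q j)"
  shows "generic_on S (\<lambda>x. \<forall>j\<in>J. Q j x)"
  using assms(3,4)
proof (induction J rule: finite_induct)
  case empty
  then show ?case using assms(2) by (auto simp: generic_on_def)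
next
  case (insert j J)
  then show ?case
    using generic_on_conj[OF assms(1), of "Q j" "\<lambda>x. \<forall>j\<in>J. Q j x"] by simp
qed

lemma linear_on_line:
  assumes "linear f"
  shows "f ((1 - r) *\<^sub>R x + r *\<^sub>R y) = f x + r *\<^sub>R (f y - f x)"
proof -
  have "f ((1 - r) *\<^sub>R x + r *\<^sub>R y) = (1 - r) *\<^sub>R f x + r *\<^sub>R f y"
    by (simp only: linear_add[OF assms] linear_scale[OF assms])
  then show ?thesis by (simp add: algebra_simps)
qed

lemma generic_on_nonzero:
  fixes f :: "'a::real_vector \<Rightarrow> 'b::real_vector"
  assumes "linear f" "x \<in> S" "f x \<noteq> 0"
  shows "generic_on S (\<lambda>x. f x \<noteq> 0)"
proof -
  have "finite {r. f ((1 - r) *\<^sub>R x + r *\<^sub>R y) = 0}" if "f x \<noteq> 0" for x y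
  proof -
    have "r = s" if "f x + r *\<^sub>R (f y - f x) = 0" "f x + s *\<^sub>R (f y - f x) = 0" for r s
      using that \<open>f x \<noteq> 0\<close>
      by (metis add_left_cancel add.right_neutral scaleR_cancel_right scaleR_zero_right)
    then have "\<exists>s. {r. f x + r *\<^sub>R (f y - f x) = 0} \<subseteq> {s}" by blast
    then show ?thesis
      unfolding linear_on_line[OF assms(1)] by (auto intro: finite_subset)
  qed
  then show ?thesis
    using assms by (auto simp: generic_on_def)
qed

lemma generic_on_inj_on:
  assumes "finite X"
  shows "generic_on UNIV (\<lambda>q :: 'w \<Rightarrow> 'b::euclidean_space. inj_on q X)"
proof -
  define pairs where "pairs = {j \<in> X \<times> X. fst j \<noteq> snd j}"
  have "generic_on UNIV (\<lambda>q :: 'w \<Rightarrow> 'b. \<forall>j\<in>pairs. q (fst j) - q (snd j) \<noteq> 0)"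
  proof (rule generic_on_ball)
    show "finite pairs" using assms by (simp add: pairs_def)
    fix j assume distinct: "j \<in> pairs"
    obtain z :: 'b where "z \<noteq> 0" using nonzero_Basis SOME_Basis by blast
    show "generic_on UNIV (\<lambda>q :: 'w \<Rightarrow> 'b. q (fst j) - q (snd j) \<noteq> 0)"
    proof (rule generic_on_nonzero)
      show "linear (\<lambda>q :: 'w \<Rightarrow> 'b. q (fst j) - q (snd j))"
        by (rule linearI) (simp_all add: algebra_simps)
      show "of_bool (fst j = fst j) *\<^sub>R z - of_bool (snd j = fst j) *\<^sub>R z \<noteq> 0"
        using distinct \<open>z \<noteq> 0\<close> by (auto simp: pairs_def)
    qed simp
  qed simp_all
  moreover have "(\<forall>j\<in>pairs. q (fst j) - q (snd j) \<noteq> 0) \<longleftrightarrow> inj_on q X" for q :: "'w \<Rightarrow> 'b"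
    by (auto simp: pairs_def inj_on_def)
  ultimately show ?thesis by simp
qed

lemma eigenvectors_indep_family:
  assumes "finite S" "linear T" "inj_on \<kappa> S"
    and "\<And>i. i \<in> S \<Longrightarrow> T (v i) = \<kappa> i *\<^sub>R v i" "\<And>i. i \<in> S \<Longrightarrow> v i \<noteq> 0"
  shows "indep_family v S"
  using assms(1,3-)
proof (induction S rule: finite_induct)
  case empty
  show ?case by simp
next
  case (insert i S)
  have indep: "indep_family v S"
    using insert.IH insert.prems by simp
  have "v i \<notin> span (v ` S)"
  proof
    assume "v i \<in> span (v ` S)"
    then obtain c where combination: "v i = (\<Sum>j\<in>S. c j *\<^sub>R v j)"
      using in_span_family_iff[OF insert.hyps(1)] by blast
    have "(\<Sum>j\<in>S. (c j * (\<kappa> j - \<kappa> i)) *\<^sub>R v j) = T (v i) - \<kappa> i *\<^sub>R v i"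
      unfolding combination using insert.prems(2)
      by (simp add: linear_sum[OF assms(2)] linear_scale[OF assms(2)] scaleR_sum_right
          sum_subtractf[symmetric] algebra_simps)
    then have "(\<Sum>j\<in>S. (c j * (\<kappa> j - \<kappa> i)) *\<^sub>R v j) = 0"
      using insert.prems(2) by simp
    then have "c j * (\<kappa> j - \<kappa> i) = 0" if "j \<in> S" for j
      using indep_familyD[OF indep insert.hyps(1), of "\<lambda>j. c j * (\<kappa> j - \<kappa> i)"] that by simp
    moreover have "\<kappa> j \<noteq> \<kappa> i" if "j \<in> S" for j
      using insert.hyps insert.prems(1) that by (auto simp: inj_on_def)
    ultimately have "v i = 0" using combination by simp
    then show False using insert.prems(3) by simp
  qed
  then show ?case
    using indep insert.hyps by (simp add: indep_family_insert)
qed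

lemma dependent_on_line_eigenvector:
  assumes "finite S" "indep_family v S" "linear T" "\<And>i. i \<in> S \<Longrightarrow> T (v i) = w i"
    and dep: "\<not> indep_family (\<lambda>i. v i + r *\<^sub>R w i) S"
  shows "\<exists>y \<in> span (v ` S). y \<noteq> 0 \<and> T y = (- 1 / r) *\<^sub>R y"
proof -
  obtain c j where relation: "(\<Sum>i\<in>S. c i *\<^sub>R (v i + r *\<^sub>R w i)) = 0" "j \<in> S" "c j \<noteq> 0"
    using dep indep_family_iff_scalars[OF assms(1), of "\<lambda>i. v i + r *\<^sub>R w i"] by blast
  define y where "y = (\<Sum>i\<in>S. c i *\<^sub>R v i)"
  have "y + r *\<^sub>R T y = (\<Sum>i\<in>S. c i *\<^sub>R (v i + r *\<^sub>R w i))"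
    by (simp add: y_def linear_sum[OF assms(3)] linear_scale[OF assms(3)] assms(4) scaleR_sum_right
        sum.distrib[symmetric] algebra_simps)
  then have kernel: "y + r *\<^sub>R T y = 0" using relation(1) by simp
  have "y \<noteq> 0"
    using indep_familyD[OF assms(2,1), of c] relation(2,3) by (auto simp: y_def)
  then have "r \<noteq> 0" using kernel by auto
  then have "T y = (- 1 / r) *\<^sub>R y"
    using arg_cong[OF kernel, of "scaleR (1 / r)"]
    by (simp add: scaleR_add_right eq_neg_iff_add_eq_0 add.commute)
  moreover have "y \<in> span (v ` S)"
    using in_span_family_iff[OF assms(1)] by (auto simp: y_def)
  ultimately show ?thesis using \<open>y \<noteq> 0\<close> by blast
qed

lemma finite_dependent_on_line:
  assumes "finite S" "indep_family v S"
  shows "finite {r. \<not> indep_family (\<lambda>i. v i + r *\<^sub>R w i) S}"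
proof -
  obtain T where extension: "linear T" "\<And>i. i \<in> S \<Longrightarrow> T (v i) = w i"
    using indep_family_linear_extend[OF assms(2)] by blast
  obtain y where eigenvectors: "\<And>r. \<not> indep_family (\<lambda>i. v i + r *\<^sub>R w i) S \<Longrightarrow>
      y r \<in> span (v ` S) \<and> y r \<noteq> 0 \<and> T (y r) = (- 1 / r) *\<^sub>R y r"
    using dependent_on_line_eigenvector[OF assms extension] by metis
  have "card A \<le> card (v ` S)"
    if "A \<subseteq> {r. \<not> indep_family (\<lambda>i. v i + r *\<^sub>R w i) S}" "finite A" for A
  proof -
    have "indep_family y A"
      by (rule eigenvectors_indep_family[OF that(2) extension(1), of "\<lambda>r. - 1 / r"])
        (use that eigenvectors in \<open>auto simp: inj_on_def\<close>)
    then show ?thesis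
      using that eigenvectors assms(1) by (intro indep_family_card_le) auto
  qed
  then show ?thesis
    using finite_if_finite_subsets_card_bdd by blast
qed

lemma generic_on_indep_family:
  assumes "finite F" "x \<in> S" "indep_family (v x) F"
    and lin: "\<And>i. i \<in> F \<Longrightarrow> linear (\<lambda>x. v x i)"
  shows "generic_on S (\<lambda>x. indep_family (v x) F)"
proof -
  have "finite {r. \<not> indep_family (v ((1 - r) *\<^sub>R x + r *\<^sub>R y)) F}"
    if "indep_family (v x) F" for x y
  proof -
    have "v ((1 - r) *\<^sub>R x + r *\<^sub>R y) i = v x i + r *\<^sub>R (v y i - v x i)" if "i \<in> F" for r i
      using linear_on_line[OF lin[OF that]] .
    then have "indep_family (v ((1 - r) *\<^sub>R x + r *\<^sub>R y)) F
        \<longleftrightarrow> indep_family (\<lambda>i. v x i + r *\<^sub>R (v y i - v x i)) F" for r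
      by (intro indep_family_cong) simp
    then show ?thesis
      using finite_dependent_on_line[OF assms(1) that] by simp
  qed
  then show ?thesis
    using assms(2,3) by (auto simp: generic_on_def)
qed

section \<open>Edge forces\<close>

definition edge_force :: "'w \<Rightarrow> 'w \<Rightarrow> 'b::real_vector \<Rightarrow> 'w \<Rightarrow> 'b" where
  "edge_force u v x w = (of_bool (w = u) - of_bool (w = v)) *\<^sub>R x"

lemma linear_edge_force: "linear (edge_force u v)"
  by (rule linearI) (simp_all add: edge_force_def fun_eq_iff scaleR_add_right)

lemma edge_force_refl [simp]: "edge_force u u x = 0"
  by (simp add: edge_force_def fun_eq_iff)

lemma edge_force_trans: "edge_force u v x + edge_force v w x = edge_force u w x"
  by (simp add: edge_force_def fun_eq_iff algebra_simps)

lemma edge_force_scaleR: "edge_force u v (r *\<^sub>R x) = r *\<^sub>R edge_force u v x"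
  by (rule linear_scale[OF linear_edge_force])

lemma sum_edge_force:
  assumes "finite X" "u \<in> X" "v \<in> X"
  shows "(\<Sum>w\<in>X. edge_force u v x w) = 0"
  using assms
  by (simp add: edge_force_def flip: scaleR_sum_left) (simp add: sum_subtractf of_bool_def)

text \<open>For \<open>\<rho> \<in> X\<close>, a basis of the forces on X of total zero.\<close>

definition force_basis :: "'w set \<Rightarrow> 'w \<Rightarrow> ('w \<Rightarrow> 'b::euclidean_space) set" where
  "force_basis X \<rho> = (\<lambda>(w, b). edge_force w \<rho> b) ` ((X - {\<rho>}) \<times> Basis)"

lemma edge_force_in_force_basis: "w \<in> X \<Longrightarrow> w \<noteq> \<rho> \<Longrightarrow> b \<in> Basis \<Longrightarrow> edge_force w \<rho> b \<in> force_basis X \<rho>"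
  by (force simp: force_basis_def)

lemma finite_force_basis: "finite X \<Longrightarrow> finite (force_basis X \<rho>)"
  by (simp add: force_basis_def)

lemma force_basis_subsetI:
  assumes "\<And>w b. w \<in> X \<Longrightarrow> edge_force w \<rho> b \<in> T"
  shows "force_basis X \<rho> \<subseteq> T"
  using assms by (auto simp: force_basis_def)

lemma edge_force_in_span_force_basis:
  fixes x :: "'b::euclidean_space"
  assumes "u \<in> X" "v \<in> X"
  shows "edge_force u v x \<in> span (force_basis X \<rho>)"
proof -
  have basis: "edge_force w \<rho> b \<in> span (force_basis X \<rho>)" if "w \<in> X" "b \<in> Basis" for w and b :: 'b
    using that by (cases "w = \<rho>") (simp_all add: span_zero span_base edge_force_in_force_basis)
  have to_root: "edge_force w \<rho> x \<in> span (force_basis X \<rho>)" if "w \<in> X" for w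
  proof -
    have "edge_force w \<rho> (\<Sum>b\<in>Basis. (x \<bullet> b) *\<^sub>R b) = (\<Sum>b\<in>Basis. (x \<bullet> b) *\<^sub>R edge_force w \<rho> b)"
      by (simp only: linear_sum[OF linear_edge_force] edge_force_scaleR)
    then have "edge_force w \<rho> x = (\<Sum>b\<in>Basis. (x \<bullet> b) *\<^sub>R edge_force w \<rho> b)"
      by (simp only: euclidean_representation)
    then show ?thesis
      using basis that by (simp add: span_sum span_scale)
  qed
  have "edge_force u v x = edge_force u \<rho> x - edge_force v \<rho> x"
    using edge_force_trans[of u v x \<rho>] by (simp add: eq_diff_eq)
  then show ?thesis
    using to_root assms by (simp add: span_diff)
qed

lemma indep_family_edge_forces_to_root:
  assumes "finite V" "\<rho> \<notin> V"
  shows "indep_family (\<lambda>(w, b). edge_force w \<rho> b) (V \<times> (Basis :: 'b::euclidean_space set))"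
  unfolding indep_family_iff_scalars[OF finite_cartesian_product[OF assms(1) finite_Basis]]
proof (intro allI impI ballI)
  fix c z assume relation: "(\<Sum>j\<in>V \<times> Basis. c j *\<^sub>R (case j of (w, b :: 'b) \<Rightarrow> edge_force w \<rho> b)) = 0"
    and "z \<in> V \<times> (Basis :: 'b set)"
  then obtain v b where index: "z = (v, b)" "v \<in> V" "b \<in> Basis" by blast
  have "0 = (\<Sum>(w, d)\<in>V \<times> Basis. c (w, d) *\<^sub>R edge_force w \<rho> d v)"
    using fun_cong[OF relation, of v] by (simp add: case_prod_unfold)
  also have "\<dots> = (\<Sum>w\<in>V. \<Sum>d\<in>Basis. c (w, d) *\<^sub>R edge_force w \<rho> d v)"
    by (simp add: sum.cartesian_product)
  also have "\<dots> = (\<Sum>w\<in>V. if w = v then \<Sum>d\<in>Basis. c (v, d) *\<^sub>R d else 0)"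
    using assms(2) index(2) by (intro sum.cong) (auto simp: edge_force_def)
  also have "\<dots> = (\<Sum>d\<in>Basis. c (v, d) *\<^sub>R d)"
    using assms(1) index(2) by simp
  finally show "c z = 0"
    using index inner_sum_left_Basis[of b "\<lambda>d. c (v, d)"] by simp
qed

lemma independent_force_basis:
  assumes "finite X"
  shows "independent (force_basis X \<rho> :: ('w \<Rightarrow> 'b::euclidean_space) set)"
  using indep_family_edge_forces_to_root[of "X - {\<rho>}" \<rho>, where 'b = 'b] assms
  by (simp add: indep_family_def force_basis_def)

lemma card_force_basis:
  assumes "finite X" "\<rho> \<in> X"
  shows "card (force_basis X \<rho> :: ('w \<Rightarrow> 'b::euclidean_space) set) + DIM('b) = DIM('b) * card X"
  using indep_family_edge_forces_to_root[of "X - {\<rho>}" \<rho>, where 'b = 'b]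
    card.remove[OF assms] assms(1)
  by (simp add: indep_family_def force_basis_def card_image card_cartesian_product)

text \<open>Linear functionals on forces are placements of the vertices.\<close>

lemma linear_functional_edge_force:
  fixes f :: "('w \<Rightarrow> 'b::euclidean_space) \<Rightarrow> real"
  assumes "linear f"
  obtains h where "\<And>u v x. f (edge_force u v x) = x \<bullet> (h u - h v)"
proof -
  fix \<rho> :: 'w
  define h where "h = (\<lambda>v. adjoint (\<lambda>x. f (edge_force v \<rho> x)) 1)"
  have to_root: "f (edge_force v \<rho> x) = x \<bullet> h v" for v x
    using adjoint_works[of "\<lambda>x. f (edge_force v \<rho> x)" x 1]
      linear_compose[OF linear_edge_force assms] by (simp add: h_def o_def)
  have "f (edge_force u v x) = x \<bullet> (h u - h v)" for u v x
  proof -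
    have "edge_force u \<rho> x = edge_force u v x + edge_force v \<rho> x"
      by (simp add: edge_force_trans)
    then show ?thesis
      using linear_add[OF assms, of "edge_force u v x" "edge_force v \<rho> x"]
        to_root[of u x] to_root[of v x]
      by (simp add: inner_diff_right)
  qed
  then show ?thesis using that by blast
qed

definition virtual_work :: "'w set \<Rightarrow> ('w \<Rightarrow> 'b::real_inner) \<Rightarrow> ('w \<Rightarrow> 'b) \<Rightarrow> real" where
  "virtual_work X h f = (\<Sum>v\<in>X. f v \<bullet> h v)"

lemma linear_virtual_work: "linear (virtual_work X h)"
  by (rule linearI)
    (simp_all add: virtual_work_def inner_add_left sum.distrib sum_distrib_left)

lemma virtual_work_edge_force:
  assumes "finite X" "u \<in> X" "v \<in> X"
  shows "virtual_work X h (edge_force u v x) = x \<bullet> (h u - h v)"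
proof -
  have "virtual_work X h (edge_force u v x)
      = (\<Sum>w\<in>X. (if w = u then x \<bullet> h w else 0) - (if w = v then x \<bullet> h w else 0))"
    unfolding virtual_work_def by (intro sum.cong) (auto simp: edge_force_def)
  then show ?thesis
    using assms by (simp add: sum_subtractf inner_diff_right)
qed

lemma edge_verts_ends:
  assumes "e \<in> F"
  shows "a e \<in> edge_verts F a b" "b e \<in> edge_verts F a b"
  using assms by (simp_all add: edge_verts_def)

definition direction_row :: "('e \<Rightarrow> 'w) \<Rightarrow> ('e \<Rightarrow> 'w) \<Rightarrow> ('e \<Rightarrow> 'b) \<Rightarrow> 'e \<Rightarrow> 'w \<Rightarrow> 'b::real_vector" where
  "direction_row a b x e = edge_force (a e) (b e) (x e)"

definition edge_dir :: "('e \<Rightarrow> 'w) \<Rightarrow> ('e \<Rightarrow> 'w) \<Rightarrow> ('w \<Rightarrow> 'b) \<Rightarrow> 'e \<Rightarrow> 'b::real_vector" where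
  "edge_dir a b p e = p (a e) - p (b e)"

lemma ex_placement:
  fixes x :: "'e \<Rightarrow> 'b::euclidean_space" and \<beta> :: "'e \<Rightarrow> real"
  assumes "finite S"
    and "\<And>\<omega>. (\<Sum>e\<in>S. \<omega> e *\<^sub>R direction_row a b x e) = 0 \<Longrightarrow> (\<Sum>e\<in>S. \<omega> e * \<beta> e) = 0"
  shows "\<exists>h. \<forall>e\<in>S. x e \<bullet> edge_dir a b h e = \<beta> e"
proof -
  obtain f where functional: "linear f" "\<And>e. e \<in> S \<Longrightarrow> f (direction_row a b x e) = \<beta> e"
    using fredholm_alternative[OF assms] by blast
  obtain h where "\<And>u v z. f (edge_force u v z) = z \<bullet> (h u - h v)"
    using linear_functional_edge_force[OF functional(1)] by blast
  then show ?thesis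
    using functional(2) by (intro exI[of _ h]) (simp add: direction_row_def edge_dir_def)
qed

section \<open>Sparse graphs with generic edge directions\<close>

definition generic_directions ::
    "'e set \<Rightarrow> ('e \<Rightarrow> 'w) \<Rightarrow> ('e \<Rightarrow> 'w) \<Rightarrow> ('e \<Rightarrow> 'b::real_vector) \<Rightarrow> bool" where
  "generic_directions S a b x \<longleftrightarrow>
     (\<forall>F\<subseteq>S. \<forall>y :: 'e \<Rightarrow> 'b.
        indep_family (direction_row a b y) F \<longrightarrow> indep_family (direction_row a b x) F)"

lemma linear_direction_row: "linear (\<lambda>x. direction_row a b x e)"
  by (rule linearI)
    (simp_all add: direction_row_def linear_add[OF linear_edge_force] edge_force_scaleR)

lemma ex_generic_directions:
  assumes "finite S"
  obtains x :: "'e \<Rightarrow> 'b::real_vector" where "generic_directions S a b x"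
proof -
  define realizable where
    "realizable = {F. F \<subseteq> S \<and> (\<exists>y :: 'e \<Rightarrow> 'b. indep_family (direction_row a b y) F)}"
  have "generic_on UNIV (\<lambda>x :: 'e \<Rightarrow> 'b. \<forall>F\<in>realizable. indep_family (direction_row a b x) F)"
  proof (rule generic_on_ball)
    show "finite realizable" using assms by (simp add: realizable_def)
    fix F assume "F \<in> realizable"
    then obtain y :: "'e \<Rightarrow> 'b" where "finite F" "indep_family (direction_row a b y) F"
      using assms by (auto simp: realizable_def intro: finite_subset)
    then show "generic_on UNIV (\<lambda>x :: 'e \<Rightarrow> 'b. indep_family (direction_row a b x) F)"
      by (intro generic_on_indep_family linear_direction_row UNIV_I)
  qed simp_all
  then obtain x :: "'e \<Rightarrow> 'b" where "\<forall>F\<in>realizable. indep_family (direction_row a b x) F"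
    unfolding generic_on_def by blast
  then have "generic_directions S a b x"
    by (auto simp: generic_directions_def realizable_def)
  then show ?thesis using that by blast
qed

lemma generic_circuit_span:
  assumes generic: "generic_directions S a b x"
    and circuit: "C \<subseteq> S" "family_circuit (direction_row a b x) C" "e \<in> C"
  shows "edge_force (a e) (b e) z \<in> span (direction_row a b x ` C)"
proof -
  define y where "y = x(e := z)"
  have agree: "direction_row a b y f = direction_row a b x f" if "f \<in> C - {e}" for f
    using that by (simp add: direction_row_def y_def)
  have "\<not> indep_family (direction_row a b y) C"
    using generic circuit(1,2) by (auto simp: generic_directions_def family_circuit_def)
  moreover have "indep_family (direction_row a b y) (C - {e})"
    using circuit(2,3) indep_family_cong[of "C - {e}", OF agree] by (simp add: family_circuit_def)
  moreover have "insert e (C - {e}) = C"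
    using circuit(3) by blast
  ultimately have "direction_row a b y e \<in> span (direction_row a b y ` (C - {e}))"
    using indep_family_insert[of e "C - {e}" "direction_row a b y"] by auto
  moreover have "direction_row a b y ` (C - {e}) \<subseteq> direction_row a b x ` C"
    using agree by auto
  ultimately have "direction_row a b y e \<in> span (direction_row a b x ` C)"
    using span_mono[of "direction_row a b y ` (C - {e})" "direction_row a b x ` C"] by blast
  then show ?thesis
    by (simp add: direction_row_def y_def)
qed

text \<open>Restricting a dependency to the edges inside a union R of components gives a dependency,
  which by minimality involves every edge.\<close>

lemma family_circuit_connected:
  assumes circuit: "family_circuit (direction_row a b x) C"
    and closed: "\<And>e. e \<in> C \<Longrightarrow> a e \<in> R \<longleftrightarrow> b e \<in> R" and "e \<in> C" "a e \<in> R"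
  shows "edge_verts C a b \<subseteq> R"
proof -
  let ?r = "direction_row a b x"
  define D where "D = {e\<in>C. a e \<in> R}"
  have fin: "finite C" using circuit by (simp add: family_circuit_def)
  obtain \<omega> where dependency: "(\<Sum>e\<in>C. \<omega> e *\<^sub>R ?r e) = 0" "\<forall>e\<in>C. \<omega> e \<noteq> 0"
    using family_circuit_dependency[OF circuit] by blast
  have "(\<Sum>e\<in>D. \<omega> e *\<^sub>R ?r e w) = 0" for w
  proof (cases "w \<in> R")
    case True
    have "(\<Sum>e\<in>D. \<omega> e *\<^sub>R ?r e w) = (\<Sum>e\<in>C. \<omega> e *\<^sub>R ?r e w)"
      by (rule sum.mono_neutral_left)
        (use fin True closed in \<open>auto simp: D_def direction_row_def edge_force_def\<close>)
    then show ?thesis using fun_cong[OF dependency(1), of w] by simp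
  next
    case False
    show ?thesis
      by (rule sum.neutral)
        (use False closed in \<open>auto simp: D_def direction_row_def edge_force_def\<close>)
  qed
  then have "(\<Sum>e\<in>D. \<omega> e *\<^sub>R ?r e) = 0"
    by (simp add: fun_eq_iff)
  moreover have "e \<in> D" "finite D" using assms(3,4) fin by (auto simp: D_def)
  ultimately have "\<not> indep_family ?r D"
    using indep_familyD[of ?r D \<omega> e] dependency(2) assms(3) by blast
  then have "D = C"
    using family_circuit_psubset[OF circuit, of D] by (auto simp: D_def)
  then show ?thesis
    using closed by (auto simp: D_def edge_verts_def)
qed

text \<open>In a dependent circuit with generic directions, a row may be replaced by any other force on
  the same edge without leaving the span of the rows. As the circuit is connected, this span
  consists of all forces of total zero on its vertices.\<close>

lemma generic_circuit_card:
  fixes a b :: "'e \<Rightarrow> 'w" and x :: "'e \<Rightarrow> 'b::euclidean_space"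
  assumes generic: "generic_directions S a b x"
    and circuit: "C \<subseteq> S" "family_circuit (direction_row a b x) C"
  shows "DIM('b) * card (edge_verts C a b) < card C + DIM('b)"
proof -
  let ?r = "direction_row a b x"
  define T where "T = span (?r ` C)"
  have fin: "finite C" using circuit(2) by (simp add: family_circuit_def)
  obtain e where edge: "e \<in> C" using family_circuit_nonempty[OF circuit(2)] by blast
  define \<rho> where "\<rho> = a e"
  define R where "R = {v. \<forall>z. edge_force v \<rho> z \<in> T}"
  have "edge_verts C a b \<subseteq> R"
  proof (rule family_circuit_connected[OF circuit(2) _ edge])
    show "a e \<in> R" by (simp add: R_def \<rho>_def T_def span_zero)
    fix f assume "f \<in> C"
    then have edge_forces: "edge_force (a f) (b f) z \<in> T" for z
      unfolding T_def by (rule generic_circuit_span[OF generic circuit])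
    have "edge_force (a f) \<rho> z \<in> T \<longleftrightarrow> edge_force (b f) \<rho> z \<in> T" for z
      using span_add_eq[of _ _ "edge_force (b f) \<rho> z"] edge_forces[of z]
        edge_force_trans[of "a f" "b f" z \<rho>]
      unfolding T_def by metis
    then show "a f \<in> R \<longleftrightarrow> b f \<in> R"
      by (simp add: R_def)
  qed
  then have "force_basis (edge_verts C a b) \<rho> \<subseteq> T"
    by (intro force_basis_subsetI) (auto simp: R_def)
  then have "card (force_basis (edge_verts C a b) \<rho> :: ('w \<Rightarrow> 'b) set) \<le> card (?r ` (C - {e}))"
    using independent_span_bound[OF _ independent_force_basis,
        of "?r ` (C - {e})" "edge_verts C a b" \<rho>]
      fin family_circuit_span_delete[OF circuit(2) edge] by (simp add: T_def edge_verts_def)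
  also have "\<dots> \<le> card (C - {e})"
    using fin by (intro card_image_le) simp
  also have "\<dots> < card C"
    using fin edge by (rule card_Diff1_less)
  finally show ?thesis
    using card_force_basis[of "edge_verts C a b" \<rho>, where 'b = 'b] fin edge
    by (simp add: edge_verts_def \<rho>_def)
qed

theorem generic_directions_indep:
  fixes x :: "'e \<Rightarrow> 'b::euclidean_space"
  assumes "finite S" "generic_directions S a b x"
    and sparse: "\<And>F. F \<subseteq> S \<Longrightarrow> F \<noteq> {} \<Longrightarrow> card F + DIM('b) \<le> DIM('b) * card (edge_verts F a b)"
  shows "indep_family (direction_row a b x) S"
proof (rule ccontr)
  assume "\<not> indep_family (direction_row a b x) S"
  then obtain C where "C \<subseteq> S" "family_circuit (direction_row a b x) C"
    using ex_family_circuit assms(1) by blast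
  then show False
    using generic_circuit_card[OF assms(2), of C] sparse[of C] family_circuit_nonempty by force
qed

section \<open>Placements orthogonal to the edges\<close>

definition edge_orthogonal ::
    "'e set \<Rightarrow> ('e \<Rightarrow> 'w) \<Rightarrow> ('e \<Rightarrow> 'w) \<Rightarrow> ('e \<Rightarrow> 'b::real_inner) \<Rightarrow> ('w \<Rightarrow> 'b) \<Rightarrow> bool" where
  "edge_orthogonal S a b x h \<longleftrightarrow> (\<forall>e\<in>S. x e \<bullet> edge_dir a b h e = 0)"

lemma virtual_work_zero_on_rows:
  assumes "finite X" "edge_verts S a b \<subseteq> X" "edge_orthogonal S a b x h"
    and "f \<in> span (direction_row a b x ` S)"
  shows "virtual_work X h f = 0"
proof (rule linear_eq_0_on_span[OF linear_virtual_work _ assms(4)])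
  fix g assume "g \<in> direction_row a b x ` S"
  then obtain e where edge: "e \<in> S" "g = direction_row a b x e" by blast
  then have "a e \<in> X" "b e \<in> X" using assms(2) by (auto simp: edge_verts_def)
  then show "virtual_work X h g = 0"
    using edge assms(1,3)
    by (simp add: direction_row_def virtual_work_edge_force edge_orthogonal_def edge_dir_def)
qed

lemma edge_orthogonal_not_in_span:
  assumes "finite X" "edge_verts S a b \<subseteq> X" "edge_orthogonal S a b x h"
    and "u \<in> X" "v \<in> X" "h u \<noteq> h v"
  shows "edge_force u v (h u - h v) \<notin> span (direction_row a b x ` S)"
proof
  assume "edge_force u v (h u - h v) \<in> span (direction_row a b x ` S)"
  then have "(h u - h v) \<bullet> (h u - h v) = 0"
    using virtual_work_zero_on_rows[OF assms(1-3)]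
      virtual_work_edge_force[OF assms(1,4,5), of h "h u - h v"] by simp
  then show False using assms(6) by simp
qed

lemma direction_rows_in_span_force_basis:
  assumes "edge_verts S a b \<subseteq> X"
  shows "direction_row a b x ` S \<subseteq> span (force_basis X \<rho>)"
  using assms unfolding direction_row_def edge_verts_def
  by (intro image_subsetI edge_force_in_span_force_basis) auto

lemma edge_orthogonal_extends_rows:
  fixes x :: "'e \<Rightarrow> 'b::euclidean_space"
  assumes verts: "finite X" "edge_verts S a b \<subseteq> X"
    and rows: "finite S" "indep_family (direction_row a b x) S"
    and orth: "edge_orthogonal S a b x h" "u \<in> X" "v \<in> X" "h u \<noteq> h v"
  defines "B \<equiv> insert (edge_force u v (h u - h v)) (direction_row a b x ` S)"
  shows "independent B" "card B = Suc (card S)" "B \<subseteq> span (force_basis X u)"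
  unfolding B_def insert_subset
  using indep_family_insert_vector[OF rows edge_orthogonal_not_in_span[OF verts orth]]
    direction_rows_in_span_force_basis[OF verts(2), of x u]
    edge_force_in_span_force_basis[OF orth(2,3), of "h u - h v" u]
  by simp_all

lemma edge_orthogonal_card_less:
  fixes x :: "'e \<Rightarrow> 'b::euclidean_space"
  assumes verts: "finite X" "edge_verts S a b \<subseteq> X"
    and rows: "finite S" "indep_family (direction_row a b x) S"
    and orth: "edge_orthogonal S a b x h" "u \<in> X" "v \<in> X" "h u \<noteq> h v"
  shows "card S + DIM('b) < DIM('b) * card X"
proof -
  note extends = edge_orthogonal_extends_rows[OF verts rows orth]
  show ?thesis
    using independent_span_bound[OF finite_force_basis[OF verts(1)] extends(1,3)] extends(2)
      card_force_basis[OF verts(1) orth(2), where 'b = 'b] by simp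
qed

lemma virtual_work_zero_on_force_basis_const:
  assumes "finite X" "\<And>f. f \<in> force_basis X u \<Longrightarrow> virtual_work X g f = 0" "u \<in> X" "w \<in> X"
  shows "g w = g u"
proof (cases "w = u")
  case False
  have "b \<bullet> (g w - g u) = 0" if "b \<in> Basis" for b
    using assms(2)[OF edge_force_in_force_basis[OF assms(4) False that]]
    by (simp add: virtual_work_edge_force[OF assms(1,4,3)])
  then have "g w - g u = 0"
    using euclidean_all_zero_iff[of "g w - g u"] inner_commute[of "g w - g u"] by metis
  then show ?thesis by simp
qed simp

lemma edge_orthogonal_unique:
  fixes a b :: "'e \<Rightarrow> 'w" and x :: "'e \<Rightarrow> 'b::euclidean_space"
  assumes verts: "finite X" "edge_verts S a b \<subseteq> X"
    and rows: "finite S" "indep_family (direction_row a b x) S"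
    and orth: "edge_orthogonal S a b x h" "u \<in> X" "v \<in> X" "h u \<noteq> h v"
    and card: "DIM('b) * card X \<le> Suc (card S + DIM('b))"
    and orth_k: "edge_orthogonal S a b x k"
  obtains c d where "\<And>w. w \<in> X \<Longrightarrow> k w = c *\<^sub>R h w + d"
proof -
  let ?y = "edge_force u v (h u - h v)"
  let ?B = "insert ?y (direction_row a b x ` S)"
  note extends = edge_orthogonal_extends_rows[OF verts rows orth]
  have "card (force_basis X u :: ('w \<Rightarrow> 'b) set) \<le> card ?B"
    unfolding extends(2) using card card_force_basis[OF verts(1) orth(2), where 'b = 'b] by simp
  then have basis: "force_basis X u \<subseteq> span ?B"
    by (rule independent_card_ge_spans[OF extends(1,3) finite_force_basis[OF verts(1)]])
  define d where "d = h u - h v"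
  define c where "c = d \<bullet> (k u - k v) / (d \<bullet> d)"
  define g where "g = (\<lambda>w. k w - c *\<^sub>R h w)"
  have orth_g: "edge_orthogonal S a b x g"
    using orth(1) orth_k by (simp add: edge_orthogonal_def edge_dir_def g_def inner_diff_right)
  have zero_on_rows: "virtual_work X g f = 0" if "f \<in> direction_row a b x ` S" for f
    using virtual_work_zero_on_rows[OF verts orth_g span_base[OF that]] .
  have "d \<bullet> d \<noteq> 0" using orth(4) by (simp add: d_def)
  moreover have "g u - g v = (k u - k v) - c *\<^sub>R d"
    by (simp add: g_def d_def algebra_simps)
  ultimately have "virtual_work X g ?y = 0"
    unfolding virtual_work_edge_force[OF verts(1) orth(2,3)] d_def[symmetric]
    by (simp add: c_def inner_diff_right)
  then have "virtual_work X g f = 0" if "f \<in> force_basis X u" for f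
    using linear_eq_0_on_span[OF linear_virtual_work[of X g], of ?B f] basis zero_on_rows that
    by blast
  then have "g w = g u" if "w \<in> X" for w
    using virtual_work_zero_on_force_basis_const[OF verts(1) _ orth(2) that] by blast
  then have "k w = c *\<^sub>R h w + g u" if "w \<in> X" for w
    using that by (metis add.commute diff_add_cancel g_def)
  then show ?thesis using that by blast
qed

lemma ex_edge_orthogonal:
  fixes x :: "'e \<Rightarrow> 'b::euclidean_space"
  assumes "edge_force u v z \<notin> span (direction_row a b x ` S)"
  obtains h where "edge_orthogonal S a b x h" "h u \<noteq> h v"
proof -
  obtain f where functional: "linear f" "f (edge_force u v z) = (1::real)"
      "\<And>g. g \<in> span (direction_row a b x ` S) \<Longrightarrow> f g = 0"
    using ex_separating_functional[OF assms] by blast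
  obtain h where placement: "\<And>u v z. f (edge_force u v z) = z \<bullet> (h u - h v)"
    using linear_functional_edge_force[OF functional(1)] by blast
  have "edge_orthogonal S a b x h"
    using functional(3) placement
    by (simp add: edge_orthogonal_def edge_dir_def span_base flip: direction_row_def placement)
  moreover have "h u \<noteq> h v"
    using functional(2) placement by auto
  ultimately show ?thesis using that by blast
qed

section \<open>Drawings with prescribed edge directions\<close>

definition rot :: "real^2 \<Rightarrow> real^2" where
  "rot x = vector [- (x $ 2), x $ 1]"

lemma rot_nth [simp]: "rot x $ 1 = - (x $ 2)" "rot x $ 2 = x $ 1"
  by (simp_all add: rot_def)

lemma linear_rot: "linear rot"
  by (rule linearI) (simp_all add: vec_eq_iff forall_2)

lemma rot_rot [simp]: "rot (rot x) = - x"
  by (simp add: vec_eq_iff forall_2)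

lemma inj_rot: "inj rot"
  by (metis injI minus_equation_iff rot_rot)

lemma inner_vec2: "(x::real^2) \<bullet> y = x $ 1 * y $ 1 + x $ 2 * y $ 2"
  by (simp add: inner_vec_def sum_2)

lemma inner_rot_self [simp]: "x \<bullet> rot x = 0"
  by (simp add: inner_vec2)

lemma orthogonal_imp_rot_multiple:
  assumes "x \<bullet> y = 0" "x \<noteq> 0"
  obtains c where "rot y = c *\<^sub>R x"
proof -
  have norm: "x $ 1 * x $ 1 + x $ 2 * x $ 2 \<noteq> 0"
    using assms(2) inner_eq_zero_iff[of x] by (simp add: inner_vec2)
  have "rot y = ((x $ 2 * y $ 1 - x $ 1 * y $ 2) / (x $ 1 * x $ 1 + x $ 2 * x $ 2)) *\<^sub>R x"
    using assms(1) norm by (simp add: vec_eq_iff forall_2 inner_vec2 field_simps) algebra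
  then show ?thesis using that by blast
qed

definition has_directions ::
    "'e set \<Rightarrow> ('e \<Rightarrow> 'w) \<Rightarrow> ('e \<Rightarrow> 'w) \<Rightarrow> ('e \<Rightarrow> 'b::real_vector) \<Rightarrow> ('w \<Rightarrow> 'b) \<Rightarrow> bool" where
  "has_directions E a b x p \<longleftrightarrow> (\<forall>e\<in>E. \<exists>r. r \<noteq> 0 \<and> edge_dir a b p e = r *\<^sub>R x e)"

lemma edge_dir_rot: "edge_dir a b (rot \<circ> h) e = rot (edge_dir a b h e)"
  by (simp add: edge_dir_def linear_diff[OF linear_rot])

lemma edge_orthogonal_rot: "edge_orthogonal E a b (edge_dir a b q) (rot \<circ> q)"
  by (simp add: edge_orthogonal_def edge_dir_rot)

lemma ex_has_directions:
  assumes "affine H" "H \<noteq> {}" "finite E" "\<And>h. h \<in> H \<Longrightarrow> edge_orthogonal E a b x h"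
    and "\<And>e. e \<in> E \<Longrightarrow> x e \<noteq> 0"
    and noncollapsing: "\<And>e. e \<in> E \<Longrightarrow> \<exists>h\<in>H. h (a e) \<noteq> h (b e)"
  obtains h where "h \<in> H" "has_directions E a b x (rot \<circ> h)"
proof -
  have "generic_on H (\<lambda>h. \<forall>e\<in>E. edge_dir a b h e \<noteq> 0)"
  proof (rule generic_on_ball[OF assms(1-3)])
    fix e assume "e \<in> E"
    then obtain h where "h \<in> H" "edge_dir a b h e \<noteq> 0"
      using noncollapsing by (auto simp: edge_dir_def)
    moreover have "linear (\<lambda>h. edge_dir a b h e)"
      by (rule linearI) (simp_all add: edge_dir_def algebra_simps)
    ultimately show "generic_on H (\<lambda>h. edge_dir a b h e \<noteq> 0)"
      by (intro generic_on_nonzero)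
  qed
  then obtain h where noncollapsed: "h \<in> H" "\<And>e. e \<in> E \<Longrightarrow> edge_dir a b h e \<noteq> 0"
    by (auto simp: generic_on_def)
  have "\<exists>r. r \<noteq> 0 \<and> edge_dir a b (rot \<circ> h) e = r *\<^sub>R x e" if edge: "e \<in> E" for e
  proof -
    obtain r where "rot (edge_dir a b h e) = r *\<^sub>R x e"
      using orthogonal_imp_rot_multiple[of "x e" "edge_dir a b h e"] assms(4,5) noncollapsed(1) edge
      by (auto simp: edge_orthogonal_def)
    moreover have "rot (edge_dir a b h e) \<noteq> 0"
      using noncollapsed(2)[OF edge] linear_injective_0[OF linear_rot] inj_rot by blast
    ultimately show ?thesis by (auto simp: edge_dir_rot)
  qed
  then show ?thesis using that noncollapsed(1) by (simp add: has_directions_def)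
qed

abbreviation rigidity_row ::
    "('e \<Rightarrow> 'w) \<Rightarrow> ('e \<Rightarrow> 'w) \<Rightarrow> ('w \<Rightarrow> 'b::real_vector) \<Rightarrow> 'e \<Rightarrow> 'w \<Rightarrow> 'b" where
  "rigidity_row a b p \<equiv> direction_row a b (edge_dir a b p)"

lemma linear_rigidity_row: "linear (\<lambda>q. rigidity_row a b q e)"
  by (rule linearI)
    (simp_all add: direction_row_def edge_dir_def edge_force_def fun_eq_iff algebra_simps)

lemma has_directions_indep_family_iff:
  assumes "has_directions E s t x p" "finite D" "D \<subseteq> E"
  shows "indep_family (direction_row a b (edge_dir s t p)) D \<longleftrightarrow> indep_family (direction_row a b x) D"
proof -
  obtain r where scaled: "\<And>e. e \<in> E \<Longrightarrow> r e \<noteq> 0 \<and> edge_dir s t p e = r e *\<^sub>R x e"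
    using assms(1) unfolding has_directions_def by metis
  have "indep_family (direction_row a b (edge_dir s t p)) D
      \<longleftrightarrow> indep_family (\<lambda>e. r e *\<^sub>R direction_row a b x e) D"
    using scaled assms(3)
    by (intro indep_family_cong) (auto simp: direction_row_def edge_force_scaleR)
  also have "\<dots> \<longleftrightarrow> indep_family (direction_row a b x) D"
    using scaled assms(2,3) by (intro indep_family_scale_iff) auto
  finally show ?thesis .
qed

lemma has_directions_family_circuit_iff:
  assumes "has_directions E s t x p"
  shows "family_circuit (direction_row a b (edge_dir s t p)) E
    \<longleftrightarrow> family_circuit (direction_row a b x) E"
  using has_directions_indep_family_iff[OF assms, of _ a b] by (auto simp: family_circuit_def)

section \<open>Laman's theorem\<close>

definition doubled_edge :: "'e set \<Rightarrow> 'e \<Rightarrow> ('e \<times> bool) set" where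
  "doubled_edge E e = insert (e, False) ((\<lambda>f. (f, True)) ` E)"

lemma card_le_doubled_edge:
  assumes "finite E" "F \<subseteq> doubled_edge E e"
  shows "card F \<le> Suc (card (fst ` F))"
proof -
  have "finite F"
    using assms finite_subset by (auto simp: doubled_edge_def)
  then have fin: "finite (doubled_edge (fst ` F) e)"
    by (simp add: doubled_edge_def)
  have "F \<subseteq> doubled_edge (fst ` F) e"
    using assms(2) by (force simp: doubled_edge_def)
  then have "card F \<le> card (doubled_edge (fst ` F) e)"
    using fin by (rule card_mono[rotated])
  also have "\<dots> = Suc (card (fst ` F))"
    using \<open>finite F\<close> card_image[of "\<lambda>f. (f, True)" "fst ` F"]
    by (auto simp: doubled_edge_def card_insert_if inj_on_def)
  finally show ?thesis .
qed

lemma generic_directions_indep_doubled_edge: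
  fixes a b :: "'e \<Rightarrow> 'w" and y :: "'e \<times> bool \<Rightarrow> 'b::euclidean_space"
  assumes "finite E" "e \<in> E" and generic: "generic_directions (E \<times> UNIV) (a \<circ> fst) (b \<circ> fst) y"
    and sparse: "\<And>F. F \<subseteq> E \<Longrightarrow> F \<noteq> {} \<Longrightarrow> card F + DIM('b) < DIM('b) * card (edge_verts F a b)"
  shows "indep_family (direction_row (a \<circ> fst) (b \<circ> fst) y) (doubled_edge E e)"
proof (rule generic_directions_indep)
  show "finite (doubled_edge E e)" using assms(1) by (simp add: doubled_edge_def)
  show "generic_directions (doubled_edge E e) (a \<circ> fst) (b \<circ> fst) y"
    using generic assms(2) unfolding generic_directions_def doubled_edge_def by blast
  fix F assume subfamily: "F \<subseteq> doubled_edge E e" "F \<noteq> {}"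
  then have "fst ` F \<subseteq> E" using assms(2) by (auto simp: doubled_edge_def)
  then have "card (fst ` F) + DIM('b) < DIM('b) * card (edge_verts (fst ` F) a b)"
    using sparse subfamily(2) by simp
  moreover have "edge_verts F (a \<circ> fst) (b \<circ> fst) = edge_verts (fst ` F) a b"
    by (simp add: edge_verts_def image_comp)
  ultimately show "card F + DIM('b) \<le> DIM('b) * card (edge_verts F (a \<circ> fst) (b \<circ> fst))"
    using card_le_doubled_edge[OF assms(1) subfamily(1)] by simp
qed

lemma ex_directions_with_spare_force:
  fixes a b :: "'e \<Rightarrow> 'w"
  assumes fin: "finite E"
    and sparse: "\<And>F. F \<subseteq> E \<Longrightarrow> F \<noteq> {} \<Longrightarrow> card F + DIM('b) < DIM('b) * card (edge_verts F a b)"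
  obtains x z :: "'e \<Rightarrow> 'b::euclidean_space" where "indep_family (direction_row a b x) E"
    "\<And>e. e \<in> E \<Longrightarrow> edge_force (a e) (b e) (z e) \<notin> span (direction_row a b x ` E)"
proof -
  obtain y :: "'e \<times> bool \<Rightarrow> 'b" where
    generic: "generic_directions (E \<times> UNIV) (a \<circ> fst) (b \<circ> fst) y"
    by (rule ex_generic_directions[of "E \<times> UNIV"]) (use fin in auto)
  let ?r = "direction_row (a \<circ> fst) (b \<circ> fst) y"
  define x where "x = (\<lambda>f. y (f, True))"
  define z where "z = (\<lambda>f. y (f, False))"
  have row: "?r (f, True) = direction_row a b x f" for f
    by (simp add: direction_row_def x_def)
  then have "?r ` (\<lambda>f. (f, True)) ` E = direction_row a b x ` E"
    by (simp add: image_image)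
  moreover have "?r (e, False) = edge_force (a e) (b e) (z e)" for e
    by (simp add: direction_row_def z_def)
  moreover have "indep_family ?r ((\<lambda>f. (f, True)) ` E) \<longleftrightarrow> indep_family (direction_row a b x) E"
    by (subst indep_family_reindex) (simp_all add: row inj_on_def)
  ultimately have spare: "indep_family (direction_row a b x) E \<and>
      edge_force (a e) (b e) (z e) \<notin> span (direction_row a b x ` E)" if "e \<in> E" for e
    using generic_directions_indep_doubled_edge[OF fin that generic sparse]
      indep_family_insert[of "(e, False)" "(\<lambda>f. (f, True)) ` E" ?r] by (auto simp: doubled_edge_def)
  moreover have "indep_family (direction_row a b x) E"
    using spare by (cases "E = {}") auto
  ultimately show ?thesis
    using that[of x z] by blast
qed

theorem laman_sparse_rows_indep:
  fixes a b :: "'e \<Rightarrow> 'w"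
  assumes fin: "finite E"
    and sparse: "\<And>F. F \<subseteq> E \<Longrightarrow> F \<noteq> {} \<Longrightarrow> card F + 3 \<le> 2 * card (edge_verts F a b)"
  obtains q :: "'w \<Rightarrow> real^2" where "indep_family (rigidity_row a b q) E"
proof -
  have "card F + DIM(real^2) < DIM(real^2) * card (edge_verts F a b)" if "F \<subseteq> E" "F \<noteq> {}" for F
    using sparse[OF that] by simp
  then obtain x z :: "'e \<Rightarrow> real^2" where indep: "indep_family (direction_row a b x) E" and
    spare: "\<And>e. e \<in> E \<Longrightarrow> edge_force (a e) (b e) (z e) \<notin> span (direction_row a b x ` E)"
    using ex_directions_with_spare_force[OF fin, of a b] by blast
  obtain h where "has_directions E a b x (rot \<circ> h)"
  proof (rule ex_has_directions)
    show "affine {h. edge_orthogonal E a b x h}"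
      by (auto simp: affine_def edge_orthogonal_def edge_dir_def inner_add_right inner_diff_right)
    show "{h. edge_orthogonal E a b x h} \<noteq> {}"
      by (auto simp: edge_orthogonal_def edge_dir_def intro: exI[of _ 0])
    show "x e \<noteq> 0" if "e \<in> E" for e
    proof
      assume "x e = 0"
      then have "direction_row a b x e = 0"
        by (simp add: direction_row_def edge_force_def fun_eq_iff)
      then show False
        using indep that dependent_zero[of "direction_row a b x ` E"]
        by (metis image_eqI indep_family_def)
    qed
    show "\<exists>h\<in>{h. edge_orthogonal E a b x h}. h (a e) \<noteq> h (b e)" if "e \<in> E" for e
      using ex_edge_orthogonal[OF spare[OF that]] by blast
  qed (use fin in auto)
  then show ?thesis
    using that indep has_directions_indep_family_iff[OF _ fin subset_refl] by blast
qed

section \<open>Rigidity circuits\<close>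

lemma rigidity_circuit_card:
  assumes "rigidity_circuit E a b"
  shows "finite E" "finite (edge_verts E a b)" "card E + 2 = 2 * card (edge_verts E a b)"
  using assms by (auto simp: rigidity_circuit_def edge_verts_def)

lemma rigidity_circuit_subset_sparse:
  assumes "rigidity_circuit E a b" "F \<subset> E" "F \<noteq> {}"
  shows "card F + 3 \<le> 2 * card (edge_verts F a b)"
proof -
  have "int (card F) \<le> 2 * int (card (edge_verts F a b)) - 3"
    using assms by (simp add: rigidity_circuit_def)
  then show ?thesis by linarith
qed

lemma rigidity_circuit_two_vertices:
  assumes "rigidity_circuit E a b"
  obtains u v where "u \<in> edge_verts E a b" "v \<in> edge_verts E a b" "u \<noteq> v"
proof -
  have "E \<noteq> {}" using rigidity_circuit_card(3)[OF assms] by (auto simp: edge_verts_def)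
  then have "card E \<noteq> 0" using rigidity_circuit_card(1)[OF assms] by simp
  then have "\<not> card (edge_verts E a b) \<le> Suc 0" using rigidity_circuit_card(3)[OF assms] by linarith
  then show ?thesis
    using that card_le_Suc0_iff_eq[OF rigidity_circuit_card(2)[OF assms]] by blast
qed

lemma rigidity_circuit_rows_dependent:
  assumes "rigidity_circuit E a b" and inj: "inj_on (q :: 'w \<Rightarrow> real^2) (edge_verts E a b)"
  shows "\<not> indep_family (rigidity_row a b q) E"
proof
  assume indep: "indep_family (rigidity_row a b q) E"
  obtain u v where distinct: "u \<in> edge_verts E a b" "v \<in> edge_verts E a b" "u \<noteq> v"
    using rigidity_circuit_two_vertices[OF assms(1)] .
  then have "(rot \<circ> q) u \<noteq> (rot \<circ> q) v"
    using inj inj_rot by (auto simp: inj_on_def)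
  then have "card E + DIM(real^2) < DIM(real^2) * card (edge_verts E a b)"
    using rigidity_circuit_card[OF assms(1)]
    by (intro edge_orthogonal_card_less[OF _ _ _ indep edge_orthogonal_rot distinct(1,2)]) simp_all
  then show False
    using rigidity_circuit_card(3)[OF assms(1)] by simp
qed

theorem ex_placement_rigidity_circuit:
  fixes a b :: "'e \<Rightarrow> 'w"
  assumes circuit: "rigidity_circuit E a b"
  obtains q :: "'w \<Rightarrow> real^2" where "inj_on q (edge_verts E a b)"
    "family_circuit (rigidity_row a b q) E"
proof -
  have "generic_on UNIV
      (\<lambda>q :: 'w \<Rightarrow> real^2. \<forall>e\<in>E. indep_family (rigidity_row a b q) (E - {e}))"
  proof (rule generic_on_ball)
    show "finite E" by (rule rigidity_circuit_card(1)[OF circuit])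
    fix e assume "e \<in> E"
    then have "card F + 3 \<le> 2 * card (edge_verts F a b)" if "F \<subseteq> E - {e}" "F \<noteq> {}" for F
      using rigidity_circuit_subset_sparse[OF circuit] that by blast
    then obtain q :: "'w \<Rightarrow> real^2" where "indep_family (rigidity_row a b q) (E - {e})"
      by (rule laman_sparse_rows_indep[of "E - {e}" a b, rotated]) (use \<open>finite E\<close> in auto)
    then show "generic_on UNIV (\<lambda>q :: 'w \<Rightarrow> real^2. indep_family (rigidity_row a b q) (E - {e}))"
      using \<open>finite E\<close> linear_rigidity_row by (intro generic_on_indep_family) auto
  qed simp_all
  from generic_on_conj[OF affine_UNIV
      generic_on_inj_on[OF rigidity_circuit_card(2)[OF circuit]] this]
  obtain q :: "'w \<Rightarrow> real^2" where "inj_on q (edge_verts E a b)"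
      "\<forall>e\<in>E. indep_family (rigidity_row a b q) (E - {e})"
    unfolding generic_on_def by blast
  then show ?thesis
    using that rigidity_circuit_rows_dependent[OF circuit] rigidity_circuit_card(1)[OF circuit]
    by (simp add: family_circuit_def)
qed

theorem rigidity_circuit_motion:
  fixes a b :: "'e \<Rightarrow> 'w"
  assumes circuit: "rigidity_circuit E a b" and inj: "inj_on q (edge_verts E a b)"
    and rows: "family_circuit (rigidity_row a b q) E"
    and orth: "edge_orthogonal E a b (edge_dir a b q) k"
  obtains c d where "\<And>w. w \<in> edge_verts E a b \<Longrightarrow> k w = c *\<^sub>R rot (q w) + d"
proof -
  obtain u v where distinct: "u \<in> edge_verts E a b" "v \<in> edge_verts E a b" "u \<noteq> v"
    using rigidity_circuit_two_vertices[OF circuit] .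
  obtain e where edge: "e \<in> E" using family_circuit_nonempty[OF rows] by blast
  have verts: "finite (edge_verts E a b)" "edge_verts (E - {e}) a b \<subseteq> edge_verts E a b"
    using rigidity_circuit_card(2)[OF circuit] by (auto simp: edge_verts_def)
  have rows_delete: "finite (E - {e})" "indep_family (rigidity_row a b q) (E - {e})"
    using rows edge by (simp_all add: family_circuit_def)
  have rotation: "edge_orthogonal (E - {e}) a b (edge_dir a b q) (rot \<circ> q)"
      "(rot \<circ> q) u \<noteq> (rot \<circ> q) v"
    using edge_orthogonal_rot inj distinct inj_rot by (auto simp: inj_on_def)
  have card: "DIM(real^2) * card (edge_verts E a b) \<le> Suc (card (E - {e}) + DIM(real^2))"
    using rigidity_circuit_card(1,3)[OF circuit] edge by simp
  have "edge_orthogonal (E - {e}) a b (edge_dir a b q) k"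
    using orth by (simp add: edge_orthogonal_def)
  from edge_orthogonal_unique[OF verts rows_delete rotation(1) distinct(1,2) rotation(2) card this]
  show ?thesis using that by (metis comp_apply)
qed

section \<open>Pinned frameworks\<close>

lemma pinned_graphD:
  assumes "pinned_graph I P E s t"
  shows "finite I" "finite P" "finite E" "I \<inter> P = {}"
    "e \<in> E \<Longrightarrow> s e \<in> I \<union> P" "e \<in> E \<Longrightarrow> t e \<in> I \<union> P"
    "e \<in> E \<Longrightarrow> ident_pins P (s e) \<noteq> ident_pins P (t e)"
  using assms by (auto simp: pinned_graph_def ident_pins_def)

lemma edge_verts_ident_pins_subset:
  assumes "pinned_graph I P E s t"
  shows "edge_verts E (ident_pins P \<circ> s) (ident_pins P \<circ> t) \<subseteq> insert None (Some ` I)"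
  using pinned_graphD(5,6)[OF assms] by (force simp: edge_verts_def ident_pins_def)

lemma assur_graph_edge_verts:
  assumes "assur_graph I P E s t"
  shows "edge_verts E (ident_pins P \<circ> s) (ident_pins P \<circ> t) = insert None (Some ` I)"
proof (rule card_subset_eq)
  have pinned: "pinned_graph I P E s t" and "int (card E) = 2 * int (card I)"
    and circuit: "rigidity_circuit E (ident_pins P \<circ> s) (ident_pins P \<circ> t)"
    using assms by (auto simp: assur_graph_def pinned_isostatic_def)
  then show "card (edge_verts E (ident_pins P \<circ> s) (ident_pins P \<circ> t))
      = card (insert None (Some ` I))"
    using rigidity_circuit_card(3)[OF circuit] pinned_graphD(1)[OF pinned] by (simp add: card_image)
  show "finite (insert None (Some ` I))" using pinned_graphD(1)[OF pinned] by simp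
  show "edge_verts E (ident_pins P \<circ> s) (ident_pins P \<circ> t) \<subseteq> insert None (Some ` I)"
    by (rule edge_verts_ident_pins_subset[OF pinned])
qed

abbreviation pinned_row ::
    "'v set \<Rightarrow> ('e \<Rightarrow> 'v) \<Rightarrow> ('e \<Rightarrow> 'v) \<Rightarrow> ('e \<Rightarrow> 'b::real_vector) \<Rightarrow> 'e \<Rightarrow> 'v option \<Rightarrow> 'b" where
  "pinned_row P s t \<equiv> direction_row (ident_pins P \<circ> s) (ident_pins P \<circ> t)"

definition pinned_part :: "'v set \<Rightarrow> ('v option \<Rightarrow> 'b::real_vector) \<Rightarrow> 'v \<Rightarrow> 'b" where
  "pinned_part I h v = (if v \<in> I then h (Some v) - h None else 0)"

lemma edge_dir_pinned_part:
  assumes "pinned_graph I P E s t" "e \<in> E"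
  shows "edge_dir s t (pinned_part I h) e = edge_dir (ident_pins P \<circ> s) (ident_pins P \<circ> t) h e"
  using pinned_graphD(4-6)[OF assms(1)] assms(2)
  by (auto simp: edge_dir_def pinned_part_def ident_pins_def)

lemma pinned_part_pin:
  assumes "pinned_graph I P E s t" "v \<in> P"
  shows "pinned_part I h v = 0"
  using pinned_graphD(4)[OF assms(1)] assms(2) by (auto simp: pinned_part_def)

lemma linear_functional_zero_inj_on:
  fixes f :: "('v \<Rightarrow> 'b::euclidean_space) \<Rightarrow> real"
  assumes "linear f" "finite P" "2 \<le> DIM('b)"
  obtains \<pi> where "inj_on \<pi> P" "f \<pi> = 0"
proof -
  obtain n :: "'v \<Rightarrow> nat" where index: "inj_on n P"
    using finite_imp_inj_to_nat_seg[OF assms(2)] by blast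
  define g where "g = (\<lambda>z :: 'b. f (\<lambda>v. real (n v) *\<^sub>R z))"
  have "linear (\<lambda>(z :: 'b) v. real (n v) *\<^sub>R z)"
    by (rule linearI) (simp_all add: fun_eq_iff scaleR_add_right)
  then have "linear g"
    using linear_compose[OF _ assms(1)] by (simp add: g_def o_def)
  obtain z where direction: "z \<noteq> 0" "orthogonal (adjoint g 1) z"
    using orthogonal_to_vector_exists[OF assms(3)] by blast
  have "g z = 0"
    using adjoint_works[OF \<open>linear g\<close>, of z 1] direction(2)
    by (simp add: orthogonal_def inner_commute)
  moreover have "inj_on (\<lambda>v. real (n v) *\<^sub>R z) P"
    using index direction(1) by (auto simp: inj_on_def)
  ultimately show ?thesis
    using that[of "\<lambda>v. real (n v) *\<^sub>R z"] by (simp add: g_def)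
qed

text \<open>Pin positions extend to a placement orthogonal to the edge directions iff they satisfy one
  linear equation, whose coefficients are the dependency of the rows.\<close>

lemma ex_edge_orthogonal_distinct_pins:
  fixes x :: "'e \<Rightarrow> 'b::euclidean_space"
  assumes pinned: "pinned_graph I P E s t" and dim: "2 \<le> DIM('b)"
    and rows: "family_circuit (pinned_row P s t x) E"
  obtains h where "edge_orthogonal E s t x h" "inj_on h P"
proof -
  let ?a = "ident_pins P \<circ> s" and ?b = "ident_pins P \<circ> t"
  obtain \<omega> where
    dependency: "\<forall>\<mu>. (\<Sum>e\<in>E. \<mu> e *\<^sub>R pinned_row P s t x e) = 0 \<longrightarrow> (\<exists>c. \<forall>e\<in>E. \<mu> e = c * \<omega> e)"
    using family_circuit_dependency[OF rows] by blast
  have "linear (\<lambda>\<pi>. \<Sum>e\<in>E. \<omega> e * (x e \<bullet> edge_dir s t \<pi> e))"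
    by (rule linearI)
      (simp_all add: edge_dir_def inner_add_right inner_diff_right algebra_simps sum.distrib
        sum_subtractf sum_distrib_left)
  then obtain \<pi> where pins: "inj_on \<pi> P" "(\<Sum>e\<in>E. \<omega> e * (x e \<bullet> edge_dir s t \<pi> e)) = 0"
    by (rule linear_functional_zero_inj_on[OF _ pinned_graphD(2)[OF pinned] dim])
  have "(\<Sum>e\<in>E. \<mu> e * - (x e \<bullet> edge_dir s t \<pi> e)) = 0"
    if relation: "(\<Sum>e\<in>E. \<mu> e *\<^sub>R pinned_row P s t x e) = 0" for \<mu>
  proof -
    obtain c where "\<And>e. e \<in> E \<Longrightarrow> \<mu> e = c * \<omega> e" using dependency relation by blast
    then have "(\<Sum>e\<in>E. \<mu> e * - (x e \<bullet> edge_dir s t \<pi> e))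
        = - c * (\<Sum>e\<in>E. \<omega> e * (x e \<bullet> edge_dir s t \<pi> e))"
      by (simp add: sum_distrib_left mult.assoc)
    then show ?thesis using pins(2) by simp
  qed
  from ex_placement[OF pinned_graphD(3)[OF pinned] this]
  obtain k where solution: "\<forall>e\<in>E. x e \<bullet> edge_dir ?a ?b k e = - (x e \<bullet> edge_dir s t \<pi> e)"
    by blast
  define h where "h = pinned_part I k + \<pi>"
  have "edge_dir s t h e = edge_dir ?a ?b k e + edge_dir s t \<pi> e" if "e \<in> E" for e
    using edge_dir_pinned_part[OF pinned that, of k] by (simp add: h_def edge_dir_def algebra_simps)
  then have "edge_orthogonal E s t x h"
    using solution by (simp add: edge_orthogonal_def inner_add_right)
  moreover have "inj_on h P"
    using pins(1) pinned_part_pin[OF pinned, of _ k] by (simp add: h_def inj_on_def)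
  ultimately show ?thesis using that by blast
qed

text \<open>Adding the rotation of the circuit about the identified pin keeps the pins and separates the
  ends of every edge.\<close>

theorem ex_drawing_distinct_pins:
  fixes q :: "'v option \<Rightarrow> real^2"
  assumes pinned: "pinned_graph I P E s t"
  defines "a \<equiv> ident_pins P \<circ> s" and "b \<equiv> ident_pins P \<circ> t"
  assumes inj: "inj_on q (edge_verts E a b)" and rows: "family_circuit (rigidity_row a b q) E"
  obtains p where "inj_on p P" "has_directions E s t (edge_dir a b q) p"
proof -
  let ?x = "edge_dir a b q"
  obtain h where orth: "edge_orthogonal E s t ?x h" "inj_on h P"
    using ex_edge_orthogonal_distinct_pins[OF pinned _ rows[unfolded a_def b_def]]
    by (auto simp: a_def b_def)
  define k where "k = h + pinned_part I (rot \<circ> q)"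
  define H where "H = {g. edge_orthogonal E s t ?x g \<and> (\<forall>v\<in>P. g v = h v)}"
  have dir_k: "edge_dir s t k e = edge_dir s t h e + rot (?x e)" if "e \<in> E" for e
    using edge_dir_pinned_part[OF pinned that, of "rot \<circ> q"] edge_dir_rot[of a b q e]
    by (simp add: edge_dir_def k_def a_def b_def algebra_simps)
  then have "edge_orthogonal E s t ?x k"
    using orth(1) by (simp add: edge_orthogonal_def inner_add_right)
  then have members: "h \<in> H" "k \<in> H"
    using orth(1) pinned_part_pin[OF pinned, of _ "rot \<circ> q"] by (simp_all add: H_def k_def)
  obtain g where drawing: "g \<in> H" "has_directions E s t ?x (rot \<circ> g)"
  proof (rule ex_has_directions[of H E s t ?x])
    show "affine H"
      by (auto simp: H_def affine_def edge_orthogonal_def edge_dir_def inner_add_right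
          inner_diff_right simp flip: scaleR_left_distrib)
    fix e assume edge: "e \<in> E"
    then have "a e \<noteq> b e" using pinned_graphD(7)[OF pinned] by (simp add: a_def b_def)
    then show nonzero: "?x e \<noteq> 0"
      using inj_on_eq_iff[OF inj edge_verts_ends[OF edge]] by (simp add: edge_dir_def)
    have "edge_dir s t k e \<noteq> edge_dir s t h e"
      using dir_k[OF edge] nonzero linear_injective_0[OF linear_rot] inj_rot by auto
    then have "h (s e) \<noteq> h (t e) \<or> k (s e) \<noteq> k (t e)"
      by (auto simp: edge_dir_def)
    then show "\<exists>g\<in>H. g (s e) \<noteq> g (t e)" using members by blast
  qed (use members pinned_graphD(3)[OF pinned] in \<open>auto simp: H_def\<close>)
  have "inj_on (rot \<circ> g) P"
    using drawing(1) orth(2) inj_rot by (auto simp: H_def inj_on_def)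
  then show ?thesis using that drawing(2) by blast
qed

lemma row_combination_zero_off_one_vertex:
  assumes "finite E"
    and zero: "\<And>w. w \<in> edge_verts E a b \<Longrightarrow> w \<noteq> \<rho> \<Longrightarrow> (\<Sum>e\<in>E. \<mu> e *\<^sub>R direction_row a b x e) w = 0"
  shows "(\<Sum>e\<in>E. \<mu> e *\<^sub>R direction_row a b x e) = 0" (is "?f = 0")
proof
  let ?X = "edge_verts E a b"
  have fin: "finite ?X" using assms(1) by (simp add: edge_verts_def)
  have "(\<Sum>w\<in>?X. ?f w) = (\<Sum>e\<in>E. \<mu> e *\<^sub>R (\<Sum>w\<in>?X. direction_row a b x e w))"
    by (simp add: scaleR_sum_right) (rule sum.swap)
  also have "\<dots> = 0"
    by (rule sum.neutral) (simp add: direction_row_def sum_edge_force[OF fin edge_verts_ends])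
  finally have total: "(\<Sum>w\<in>?X. ?f w) = 0" .
  fix w
  have "?f w = 0"
  proof (cases "w \<in> ?X")
    case True
    show ?thesis
    proof (cases "w = \<rho>")
      case True
      then have "(\<Sum>v\<in>?X. ?f v) = ?f w"
        using fin zero \<open>w \<in> ?X\<close> by (simp add: sum.remove[of ?X w])
      then show ?thesis using total by simp
    qed (use True zero in blast)
  next
    case False
    then have "direction_row a b x e w = 0" if "e \<in> E" for e
      using edge_verts_ends[OF that, where a = a and b = b]
      by (auto simp: direction_row_def edge_force_def)
    then show ?thesis by simp
  qed
  then show "?f w = 0 w" by simp
qed

lemma self_stress_iff_dependency:
  assumes pinned: "pinned_graph I P E s t"
  shows "self_stress I E s t p \<mu> \<longleftrightarrow> (\<forall>e. e \<notin> E \<longrightarrow> \<mu> e = 0) \<and>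
    (\<Sum>e\<in>E. \<mu> e *\<^sub>R pinned_row P s t (edge_dir s t p) e) = 0"
    (is "_ \<longleftrightarrow> _ \<and> ?f = 0")
proof -
  have fin: "finite E" by (rule pinned_graphD(3)[OF pinned])
  have at_inner: "(\<Sum>e\<in>{e\<in>E. s e = i}. \<mu> e *\<^sub>R (p i - p (t e)))
      + (\<Sum>e\<in>{e\<in>E. t e = i}. \<mu> e *\<^sub>R (p i - p (s e))) = ?f (Some i)" if inner: "i \<in> I" for i
  proof -
    have ident: "Some i = ident_pins P v \<longleftrightarrow> v = i" for v
      using inner pinned_graphD(4)[OF pinned] by (auto simp: ident_pins_def)
    have "(\<Sum>e\<in>{e\<in>E. s e = i}. \<mu> e *\<^sub>R (p i - p (t e)))
        = (\<Sum>e\<in>E. of_bool (s e = i) *\<^sub>R \<mu> e *\<^sub>R edge_dir s t p e)"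
      by (rule sum.mono_neutral_cong_left) (use fin in \<open>auto simp: edge_dir_def\<close>)
    moreover have "(\<Sum>e\<in>{e\<in>E. t e = i}. \<mu> e *\<^sub>R (p i - p (s e)))
        = (\<Sum>e\<in>E. - (of_bool (t e = i) *\<^sub>R \<mu> e *\<^sub>R edge_dir s t p e))"
      by (rule sum.mono_neutral_cong_left)
        (use fin in \<open>auto simp: edge_dir_def simp flip: scaleR_minus_right\<close>)
    ultimately show ?thesis
      by (simp add: direction_row_def edge_force_def ident sum.distrib[symmetric]
          scaleR_left_diff_distrib algebra_simps)
  qed
  have "?f = 0 \<longleftrightarrow> (\<forall>i\<in>I. ?f (Some i) = 0)"
  proof
    assume "\<forall>i\<in>I. ?f (Some i) = 0"
    then show "?f = 0"
      using edge_verts_ident_pins_subset[OF pinned]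
      by (intro row_combination_zero_off_one_vertex[OF fin, where \<rho> = None]) blast
  qed simp
  then show ?thesis
    unfolding self_stress_def using at_inner by simp
qed

lemma self_stress_line:
  assumes pinned: "pinned_graph I P E s t"
    and rows: "family_circuit (pinned_row P s t (edge_dir s t p)) E"
  shows "\<exists>\<omega>. self_stress I E s t p \<omega> \<and> (\<forall>e\<in>E. \<omega> e \<noteq> 0) \<and>
    (\<forall>\<mu>. self_stress I E s t p \<mu> \<longrightarrow> (\<exists>c. \<mu> = (\<lambda>e. c * \<omega> e)))"
proof -
  let ?r = "pinned_row P s t (edge_dir s t p)"
  note stress_iff = self_stress_iff_dependency[OF pinned]
  obtain \<omega> where dependency: "(\<Sum>e\<in>E. \<omega> e *\<^sub>R ?r e) = 0" "\<forall>e\<in>E. \<omega> e \<noteq> 0"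
      "\<forall>\<mu>. (\<Sum>e\<in>E. \<mu> e *\<^sub>R ?r e) = 0 \<longrightarrow> (\<exists>c. \<forall>e\<in>E. \<mu> e = c * \<omega> e)"
    using family_circuit_dependency[OF rows] by blast
  define \<sigma> where "\<sigma> = (\<lambda>e. if e \<in> E then \<omega> e else 0)"
  have "self_stress I E s t p \<sigma>"
    using dependency(1) by (simp add: stress_iff \<sigma>_def cong: sum.cong)
  moreover have "\<exists>c. \<mu> = (\<lambda>e. c * \<sigma> e)" if stress: "self_stress I E s t p \<mu>" for \<mu>
  proof -
    obtain c where "\<forall>e\<in>E. \<mu> e = c * \<omega> e"
      using dependency(3) stress unfolding stress_iff by blast
    then have "\<mu> e = c * \<sigma> e" for e
      using stress unfolding stress_iff by (simp add: \<sigma>_def)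
    then show ?thesis by blast
  qed
  moreover have "\<forall>e\<in>E. \<sigma> e \<noteq> 0"
    using dependency(2) by (simp add: \<sigma>_def)
  ultimately show ?thesis by blast
qed

lemma first_order_motion_iff_edge_orthogonal:
  assumes "has_directions E s t x p"
  shows "first_order_motion I E s t p m \<longleftrightarrow> (\<forall>v. v \<notin> I \<longrightarrow> m v = 0) \<and> edge_orthogonal E s t x m"
proof -
  have "edge_dir s t p e \<bullet> edge_dir s t m e = 0 \<longleftrightarrow> x e \<bullet> edge_dir s t m e = 0" if "e \<in> E" for e
    using assms that by (auto simp: has_directions_def)
  then show ?thesis
    by (simp add: first_order_motion_def edge_orthogonal_def flip: edge_dir_def)
qed

lemma first_order_motion_line:
  fixes q :: "'v option \<Rightarrow> real^2"
  assumes assur: "assur_graph I P E s t"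
  defines "a \<equiv> ident_pins P \<circ> s" and "b \<equiv> ident_pins P \<circ> t"
  assumes inj: "inj_on q (edge_verts E a b)" and rows: "family_circuit (rigidity_row a b q) E"
    and dirs: "has_directions E s t (edge_dir a b q) p"
  shows "\<exists>m. first_order_motion I E s t p m \<and> (\<forall>i\<in>I. m i \<noteq> 0) \<and>
    (\<forall>m'. first_order_motion I E s t p m' \<longrightarrow> (\<exists>c. m' = (\<lambda>v. c *\<^sub>R m v)))"
proof -
  have pinned: "pinned_graph I P E s t" and circuit: "rigidity_circuit E a b"
    using assur by (simp_all add: assur_graph_def pinned_isostatic_def a_def b_def)
  have verts: "edge_verts E a b = insert None (Some ` I)"
    unfolding a_def b_def by (rule assur_graph_edge_verts[OF assur])
  define m where "m = pinned_part I (rot \<circ> q)"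
  have "first_order_motion I E s t p m"
    using edge_orthogonal_rot[of E a b q] edge_dir_pinned_part[OF pinned, of _ "rot \<circ> q"]
    by (simp add: first_order_motion_iff_edge_orthogonal[OF dirs] edge_orthogonal_def m_def
        pinned_part_def a_def b_def)
  moreover have "m i \<noteq> 0" if "i \<in> I" for i
    using that inj verts inj_rot by (auto simp: m_def pinned_part_def inj_on_def)
  moreover have "\<exists>c. m' = (\<lambda>v. c *\<^sub>R m v)" if motion: "first_order_motion I E s t p m'" for m'
  proof -
    define k where "k = case_option 0 m'"
    have "m' v = 0" if "v \<notin> I" for v
      using motion that by (simp add: first_order_motion_def)
    then have "m' = pinned_part I k"
      by (auto simp: pinned_part_def k_def fun_eq_iff)
    then have "edge_orthogonal E a b (edge_dir a b q) k"
      using motion edge_dir_pinned_part[OF pinned, of _ k]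
      by (simp add: first_order_motion_iff_edge_orthogonal[OF dirs] edge_orthogonal_def a_def b_def)
    then obtain c d where affine: "\<And>w. w \<in> edge_verts E a b \<Longrightarrow> k w = c *\<^sub>R rot (q w) + d"
      using rigidity_circuit_motion[OF circuit inj rows] by blast
    have "m' v = c *\<^sub>R m v" for v
      using affine[of None] affine[of "Some v"] verts \<open>m' = pinned_part I k\<close>
      by (simp add: m_def pinned_part_def algebra_simps)
    then show ?thesis by blast
  qed
  ultimately show ?thesis by blast
qed

theorem theorem3p2:
  fixes I P :: "'v set" and E :: "'e set" and s t :: "'e \<Rightarrow> 'v"
  assumes "assur_graph I P E s t"
    and "planar (I \<union> P) E s t"
    and "planar (ident_pins P ` (I \<union> P)) E (ident_pins P \<circ> s) (ident_pins P \<circ> t)"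
  shows "\<exists>p :: 'v \<Rightarrow> real^2. inj_on p P \<and>
     (\<exists>\<omega>. self_stress I E s t p \<omega> \<and> (\<forall>e\<in>E. \<omega> e \<noteq> 0) \<and>
        (\<forall>\<mu>. self_stress I E s t p \<mu> \<longrightarrow> (\<exists>c::real. \<mu> = (\<lambda>e. c * \<omega> e)))) \<and>
     (\<exists>m. first_order_motion I E s t p m \<and> (\<forall>i\<in>I. m i \<noteq> 0) \<and>
        (\<forall>m'. first_order_motion I E s t p m' \<longrightarrow> (\<exists>c::real. m' = (\<lambda>v. c *\<^sub>R m v))))"
proof -
  let ?a = "ident_pins P \<circ> s" and ?b = "ident_pins P \<circ> t"
  have pinned: "pinned_graph I P E s t" and circuit: "rigidity_circuit E ?a ?b"
    using assms(1) by (simp_all add: assur_graph_def pinned_isostatic_def)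
  obtain q :: "'v option \<Rightarrow> real^2" where generic: "inj_on q (edge_verts E ?a ?b)"
      "family_circuit (rigidity_row ?a ?b q) E"
    using ex_placement_rigidity_circuit[OF circuit] .
  obtain p where "inj_on p P" and dirs: "has_directions E s t (edge_dir ?a ?b q) p"
    using ex_drawing_distinct_pins[OF pinned generic] .
  moreover have "family_circuit (pinned_row P s t (edge_dir s t p)) E"
    using generic(2) has_directions_family_circuit_iff[OF dirs] by blast
  ultimately show ?thesis
    using self_stress_line[OF pinned] first_order_motion_line[OF assms(1) generic dirs] by blast
qed

end
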